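(* Let $f\in BV_{||0||}(\mathbb{R}^2)$ and $(x,y)\in\mathbb{R}^2$. Then $$\lim_{\substack{\alpha_1,\alpha_2\to 0\\ \beta_1,\beta_2\to\infty}}\frac{1}{4\pi^2}\iint_{R_{\alpha_1,\alpha_2}^{\beta_1,\beta_2}}\mathcal{F}(f)(\xi,\eta)\,e^{i(x\xi+y\eta)}\,d(\xi,\eta)=\frac{f(x+,y+)+f(x+,y-)+f(x-,y+)+f(x-,y-)}{4},$$ where $\mathcal F(f)$ is the KP-Fourier transform of $f$.
   Context: For a real function $f$ and points $x_{i-1}\le x_i$, $y_{j-1}\le y_j$ put $\Delta f(x_i,y_j)=f(x_i,y_j)-f(x_{i-1},y_j)-f(x_i,y_{j-1})+f(x_{i-1},y_{j-1})$. A partition of a compact rectangle $R=[a,b]\times[c,d]$ is a finite grid of cells $[x_{i-1},x_i]\times[y_{j-1},y_j]$ with $a=x_0<\dots<x_n=b$, $c=y_0<\dots<y_m=d$. A function $f:\mathbb{R}^2\to\mathbb{R}$ is of bounded variation in the Vitali sense, $f\in BV_V(\mathbb{R}^2)$, if $Var(f,\mathbb{R}^2)=\sup_R\sup\sum_{i,j}|\Delta f(x_i,y_j)|<\infty$, the suprema being over compact rectangles $R\subset\mathbb{R}^2$ and partitions of $R$. $BV_{||0||}(\mathbb{R}^2)$ is the set of $f\in BV_V(\mathbb{R}^2)$ with $\lim_{\|(x,y)\|\to\infty}f(x,y)=0$. The KP-Fourier transform of $f$ at $(\xi,\eta)$ is $$\mathcal F(f)(\xi,\eta)=\lim_{\substack{a,c\to-\infty\\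 b,d\to\infty}}\iint_{[a,b]\times[c,d]}f(t_1,t_2)e^{-i(\xi t_1+\eta t_2)}\,d(t_1,t_2),$$ when this limit exists in the Pringsheim sense (i.e. as a joint limit with $a,c\to-\infty$ and $b,d\to\infty$ independently); the integrals over compact rectangles are Kurzweil–Henstock integrals (agreeing with the Lebesgue integral for Lebesgue integrable integrands). For $f\in BV_{||0||}(\mathbb{R}^2)$ it is defined whenever $\xi\ne0$ and $\eta\neq 0$. For $0<\alpha_i<\beta_i<\infty$ ($i=1,2$), $R_{\alpha_1,\alpha_2}^{\beta_1,\beta_2}=\{(\xi,\eta)\in\mathbb{R}^2:\alpha_1\le|\xi|\le\beta_1,\ \alpha_2\le|\eta|\le\beta_2\}$. The limit in the claim is the joint limit as $\alpha_1,\alpha_2\to0^+$ and $\beta_1,\beta_2\to\infty$ independently. The quantities $f(x\pm,y\pm)$ are the one-sided quadrant limits, e.g. $f(x+,y-)=\lim_{s\to x^+,\,t\to y^-}f(s,t)$. *)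

theory Defs
  imports "HOL-Analysis.Analysis"
begin

definition rect_diff :: "(real \<times> real \<Rightarrow> real) \<Rightarrow> real \<Rightarrow> real \<Rightarrow> real \<Rightarrow> real \<Rightarrow> real" where
  "rect_diff f x' x y' y = f (x, y) - f (x', y) - f (x, y') + f (x', y')"

text \<open>The points of a partition are \<open>p 0 < \<dots> < p n\<close>; the values of \<open>p\<close> beyond \<open>n\<close> are irrelevant.\<close>

definition interval_partition :: "real \<Rightarrow> real \<Rightarrow> nat \<Rightarrow> (nat \<Rightarrow> real) \<Rightarrow> bool" where
  "interval_partition a b n p \<longleftrightarrow> p 0 = a \<and> p n = b \<and> (\<forall>i<n. p i < p (Suc i))"

definition vitali_sum ::
    "(real \<times> real \<Rightarrow> real) \<Rightarrow> nat \<Rightarrow> (nat \<Rightarrow> real) \<Rightarrow> nat \<Rightarrow> (nat \<Rightarrow> real) \<Rightarrow> real" where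
  "vitali_sum f n p m q =
    (\<Sum>i=1..n. \<Sum>j=1..m. \<bar>rect_diff f (p (i - 1)) (p i) (q (j - 1)) (q j)\<bar>)"

definition vitali_variation_on ::
    "(real \<times> real \<Rightarrow> real) \<Rightarrow> real \<Rightarrow> real \<Rightarrow> real \<Rightarrow> real \<Rightarrow> ereal" where
  "vitali_variation_on f a b c d =
    Sup {ereal (vitali_sum f n p m q) | n p m q.
           interval_partition a b n p \<and> interval_partition c d m q}"

definition vitali_variation :: "(real \<times> real \<Rightarrow> real) \<Rightarrow> ereal" where
  "vitali_variation f = Sup {vitali_variation_on f a b c d | a b c d. a < b \<and> c < d}"

definition BV_Vitali :: "(real \<times> real \<Rightarrow> real) set" where
  "BV_Vitali = {f. vitali_variation f < \<infinity>}"

definition BV_norm0 :: "(real \<times> real \<Rightarrow> real) set" where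
  "BV_norm0 = {f \<in> BV_Vitali. (f \<longlongrightarrow> 0) at_infinity}"

definition fourier_integrand ::
    "(real \<times> real \<Rightarrow> real) \<Rightarrow> real \<Rightarrow> real \<Rightarrow> real \<times> real \<Rightarrow> complex" where
  "fourier_integrand f \<xi> \<eta> =
    (\<lambda>(t1, t2). of_real (f (t1, t2)) * exp (- (\<i> * of_real (\<xi> * t1 + \<eta> * t2))))"

text \<open>All integrals are Henstock--Kurzweil integrals. The Pringsheim limit is the limit along a
  product of four filters, for \<open>a\<close>, \<open>b\<close>, \<open>c\<close> and \<open>d\<close>, in this order.
  Integrability is required explicitly because \<open>integral\<close> is \<open>0\<close> on non-integrable functions.\<close>

definition has_KP_fourier ::
    "(real \<times> real \<Rightarrow> real) \<Rightarrow> real \<Rightarrow> real \<Rightarrow> complex \<Rightarrow> bool" where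
  "has_KP_fourier f \<xi> \<eta> z \<longleftrightarrow>
    (\<forall>a b c d. fourier_integrand f \<xi> \<eta> integrable_on cbox (a, c) (b, d)) \<and>
    ((\<lambda>(a, b, c, d). integral (cbox (a, c) (b, d)) (fourier_integrand f \<xi> \<eta>)) \<longlongrightarrow> z)
      (at_bot \<times>\<^sub>F at_top \<times>\<^sub>F at_bot \<times>\<^sub>F at_top)"

text \<open>The limit is unique where it exists; elsewhere the value is unspecified.\<close>

definition KP_fourier :: "(real \<times> real \<Rightarrow> real) \<Rightarrow> real \<Rightarrow> real \<Rightarrow> complex" where
  "KP_fourier f \<xi> \<eta> = (THE z. has_KP_fourier f \<xi> \<eta> z)"

definition freq_region :: "real \<Rightarrow> real \<Rightarrow> real \<Rightarrow> real \<Rightarrow> (real \<times> real) set" where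
  "freq_region \<alpha>1 \<alpha>2 \<beta>1 \<beta>2 = {(\<xi>, \<eta>). \<alpha>1 \<le> \<bar>\<xi>\<bar> \<and> \<bar>\<xi>\<bar> \<le> \<beta>1 \<and> \<alpha>2 \<le> \<bar>\<eta>\<bar> \<and> \<bar>\<eta>\<bar> \<le> \<beta>2}"

definition inversion_integrand ::
    "(real \<times> real \<Rightarrow> real) \<Rightarrow> real \<Rightarrow> real \<Rightarrow> real \<times> real \<Rightarrow> complex" where
  "inversion_integrand f x y =
    (\<lambda>(\<xi>, \<eta>). KP_fourier f \<xi> \<eta> * exp (\<i> * of_real (x * \<xi> + y * \<eta>)))"

end

theory Submission
  imports Defs "HOL-Probability.Probability"
begin

text \<open>A function of bounded Vitali variation that vanishes at infinity is a difference of two bounded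
  functions with nonnegative rectangle increments. Each of them is, up to one-sided limits, the
  distribution function \<open>N {(u, v). u < s \<and> v < t}\<close> of a finite measure \<open>N\<close>, so that \<open>f\<close> agrees
  almost everywhere with the distribution function of a finite signed measure \<open>\<mu>\<close>, whose marginals
  vanish because \<open>f\<close> does so at infinity. By Fubini's theorem and dominated convergence the transform
  of \<open>f\<close> at \<open>(\<xi>, \<eta>)\<close> is the Fourier--Stieltjes transform of \<open>\<mu>\<close> divided by \<open>(\<i>\<xi>)(\<i>\<eta>)\<close>; all boundary
  terms are killed by the vanishing marginals. A second use of Fubini's theorem turns the truncated
  inversion integral into the \<open>\<mu>\<close>-integral of a product of sine integrals in \<open>x - u\<close> and \<open>y - v\<close>,
  which converges boundedly to \<open>\<pi>\<^sup>2 sgn (x - u) sgn (y - v)\<close>. Since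
  \<open>sgn (x - u) = 1[u < x] + 1[u \<le> x] - 1\<close>, integrating yields the sum of the four quadrant limits.\<close>

text \<open>Two obstacles shape the construction. First, Vitali variation sees f only through
  rectangle increments, which do not change when a function of one coordinate is added. It is the
  decay at infinity that removes this freedom, once when the Jordan parts are normalised and once
  more in the marginals. Secondly, the values of f at its jumps may be unrelated to its one-sided
  limits, so neither Jordan part need be continuous from any side. Measures are therefore matched to
  them by inequalities on open quadrants, and f is recovered only off countably many lines, which
  the integrals ignore. The Pringsheim limit and the truncation limit run along products of four
  filters rather than along sequences, hence the separate treatment of dominated
  convergence.\<close>

subsection \<open>Jordan decomposition of functions of bounded Vitali variation\<close>

text \<open>The largest point of \<open>A\<close> is its own successor, which makes the cells beyond it degenerate.\<close>

definition next_in :: "real set \<Rightarrow> real \<Rightarrow> real" where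
  "next_in A u = (if \<exists>v\<in>A. u < v then Min {v \<in> A. u < v} else u)"

lemma next_in_props:
  assumes "finite A" "v \<in> A" "u < v"
  shows "next_in A u \<in> A" "u < next_in A u" "next_in A u \<le> v"
proof -
  let ?S = "{v \<in> A. u < v}"
  have "finite ?S" "v \<in> ?S" using assms by auto
  then have "Min ?S \<in> ?S" "Min ?S \<le> v" using Min_in[of ?S] Min_le[of ?S v] by blast+
  moreover have "next_in A u = Min ?S" using assms by (auto simp: next_in_def)
  ultimately show "next_in A u \<in> A" "u < next_in A u" "next_in A u \<le> v" by auto
qed

lemma next_in_eqI:
  assumes "finite A" "v \<in> A" "u < v" "\<And>w. w \<in> A \<Longrightarrow> u < w \<Longrightarrow> v \<le> w"
  shows "next_in A u = v"
  using next_in_props[OF assms(1-3)] assms(4) by (simp add: antisym)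

lemma next_in_top: "(\<And>v. v \<in> A \<Longrightarrow> v \<le> u) \<Longrightarrow> next_in A u = u"
  by (force simp: next_in_def)

lemma next_in_insert:
  assumes "finite A"
  shows "next_in (insert w A) u =
    (if u < w \<and> ((\<exists>v\<in>A. u < v) \<longrightarrow> w < next_in A u) then w else next_in A u)"
proof (cases "\<exists>v\<in>A. u < v")
  case True
  then obtain v where v: "v \<in> A" "u < v" by auto
  note p = next_in_props[OF assms v]
  have q: "\<And>z. z \<in> A \<Longrightarrow> u < z \<Longrightarrow> next_in A u \<le> z" using next_in_props[OF assms] by auto
  show ?thesis
  proof (cases "u < w \<and> w < next_in A u")
    case True
    then show ?thesis using assms q
      by (auto intro!: next_in_eqI dest: less_le_trans less_imp_le) (meson less_le_trans less_imp_le)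
  next
    case False
    then show ?thesis using assms p q v
      by (auto intro!: next_in_eqI)
  qed
next
  case False
  show ?thesis
  proof (cases "u < w")
    case True
    then show ?thesis using False assms by (auto intro!: next_in_eqI)
  next
    case F2: False
    then show ?thesis using False assms by (auto simp: next_in_def)
  qed
qed

text \<open>A new point splits at most one cell, where the triangle inequality for
  \<open>\<phi>\<close> applies; any other new term is nonnegative. Since \<open>b\<close> lies in
  \<open>A\<close> and bounds \<open>I\<close>, the successor of a point of
  \<open>A \<inter> I\<close> is at most \<open>b\<close>, so a point \<open>w\<close> that splits
  its cell lies in \<open>I\<close> again. \<open>\<phi>\<close> is kept abstract so that it can
  later be a whole column sum.\<close>

lemma sum_next_in_insert_le:
  fixes \<phi> :: "real \<Rightarrow> real \<Rightarrow> real"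
  assumes nonneg: "\<And>u v. 0 \<le> \<phi> u v" and refl: "\<And>u. \<phi> u u = 0"
    and tri: "\<And>u v w. \<phi> u w \<le> \<phi> u v + \<phi> v w"
    and A: "finite A" "b \<in> A" and I: "I \<subseteq> {..<b}" "\<And>u w. u \<in> I \<Longrightarrow> u \<le> w \<Longrightarrow> w < b \<Longrightarrow> w \<in> I"
  shows "(\<Sum>u\<in>A \<inter> I. \<phi> u (next_in A u)) \<le> (\<Sum>u\<in>insert w A \<inter> I. \<phi> u (next_in (insert w A) u))"
proof (cases "w \<in> A")
  case True
  then show ?thesis by (simp add: insert_absorb)
next
  case wA: False
  let ?n = "next_in A" and ?n' = "next_in (insert w A)"
  \<comment> \<open>The left end points of cells with \<open>w\<close> in the interior; by
    \<open>uniq\<close> there is at most one.\<close>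
  define B where "B = {u \<in> A \<inter> I. u < w \<and> w < ?n u}"
  have ub: "\<exists>v\<in>A. u < v" if "u \<in> A \<inter> I" for u using that A I by auto
  have uniq: "u = u'" if "u \<in> B" "u' \<in> B" for u u'
  proof (rule ccontr)
    assume "u \<noteq> u'"
    then consider "u < u'" | "u' < u" by linarith
    then show False
      using that next_in_props(3)[OF A(1), of u' u] next_in_props(3)[OF A(1), of u u']
      by cases (auto simp: B_def)
  qed
  have same: "?n' u = ?n u" if "u \<in> A \<inter> I - B" for u
    using that ub[of u] A by (auto simp: next_in_insert B_def)
  have fin: "finite (A \<inter> I)" using A by auto
  have split: "(\<Sum>u\<in>A \<inter> I. g u) = (\<Sum>u\<in>A \<inter> I - B. g u) + (\<Sum>u\<in>B. g u)" for g :: "real \<Rightarrow> real"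
    using fin by (subst sum.subset_diff[of B "A \<inter> I"]) (auto simp: B_def)
  show ?thesis
  proof (cases "B = {}")
    case True
    then have "(\<Sum>u\<in>A \<inter> I. \<phi> u (?n u)) = (\<Sum>u\<in>A \<inter> I. \<phi> u (?n' u))"
      using same by (intro sum.cong) auto
    also have "\<dots> \<le> (\<Sum>u\<in>insert w A \<inter> I. \<phi> u (?n' u))"
      using A nonneg by (intro sum_mono2) auto
    finally show ?thesis .
  next
    case False
    then obtain p where p: "p \<in> B" by auto
    with uniq have B: "B = {p}" by auto
    have pI: "p \<in> A" "p \<in> I" "p < w" "w < ?n p" using p by (auto simp: B_def)
    have np: "?n p \<le> b" "?n p \<in> A" using next_in_props[OF A] pI I by auto
    have wI: "w \<in> I" using I(2)[of p w] pI np by auto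
    have n'p: "?n' p = w" using pI np A by (auto simp: next_in_insert)
    have n'w: "?n' w = ?n p"
      using pI np A next_in_props(3)[OF A(1), of _ p]
      by (intro next_in_eqI) (auto dest: less_trans)
    have "(\<Sum>u\<in>A \<inter> I. \<phi> u (?n u)) = (\<Sum>u\<in>A \<inter> I - {p}. \<phi> u (?n' u)) + \<phi> p (?n p)"
      unfolding split B using same B by simp
    also have "\<dots> \<le> (\<Sum>u\<in>A \<inter> I - {p}. \<phi> u (?n' u)) + (\<phi> p (?n' p) + \<phi> w (?n' w))"
      using tri[of p "?n p" w] by (simp add: n'p n'w)
    also have "\<dots> = (\<Sum>u\<in>insert w (A \<inter> I). \<phi> u (?n' u))"
      using split[of "\<lambda>u. \<phi> u (?n' u)"] fin wA B by simp
    also have "insert w (A \<inter> I) = insert w A \<inter> I" using wI by auto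
    finally show ?thesis .
  qed
qed

lemma sum_next_in_mono:
  fixes \<phi> :: "real \<Rightarrow> real \<Rightarrow> real"
  assumes nonneg: "\<And>u v. 0 \<le> \<phi> u v" and refl: "\<And>u. \<phi> u u = 0"
    and tri: "\<And>u v w. \<phi> u w \<le> \<phi> u v + \<phi> v w"
    and A: "finite A'" "A \<subseteq> A'" "b \<in> A"
    and I: "I \<subseteq> {..<b}" "\<And>u w. u \<in> I \<Longrightarrow> u \<le> w \<Longrightarrow> w < b \<Longrightarrow> w \<in> I"
  shows "(\<Sum>u\<in>A \<inter> I. \<phi> u (next_in A u)) \<le> (\<Sum>u\<in>A' \<inter> I. \<phi> u (next_in A' u))"
proof -
  have "(\<Sum>u\<in>A \<inter> I. \<phi> u (next_in A u)) \<le> (\<Sum>u\<in>(A \<union> C) \<inter> I. \<phi> u (next_in (A \<union> C) u))"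
    if "finite C" for C
    using that
  proof (induction C)
    case (insert w C)
    have "finite (A \<union> C)" using A insert finite_subset by auto
    then have "(\<Sum>u\<in>(A \<union> C) \<inter> I. \<phi> u (next_in (A \<union> C) u))
        \<le> (\<Sum>u\<in>insert w (A \<union> C) \<inter> I. \<phi> u (next_in (insert w (A \<union> C)) u))"
      using A(3) by (intro sum_next_in_insert_le[OF nonneg refl tri _ _ I]) simp_all
    with insert.IH show ?case by simp
  qed auto
  from this[of A'] A show ?thesis by (simp add: sup_absorb2)
qed

lemma sum_next_in_ge:
  fixes \<phi> :: "real \<Rightarrow> real \<Rightarrow> real"
  assumes nonneg: "\<And>u v. 0 \<le> \<phi> u v" and refl: "\<And>u. \<phi> u u = 0"
    and tri: "\<And>u v w. \<phi> u w \<le> \<phi> u v + \<phi> v w"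
    and A: "finite A" "a \<in> A" "b \<in> A" "a \<le> b"
  shows "\<phi> a b \<le> (\<Sum>u\<in>A \<inter> {a..<b}. \<phi> u (next_in A u))"
proof (cases "a = b")
  case True
  then show ?thesis by (simp add: refl)
next
  case False
  have "{a, b} \<inter> {a..<b} = {a}" using A False by auto
  moreover have "next_in {a, b} a = b" using A False by (intro next_in_eqI) auto
  ultimately have "\<phi> a b = (\<Sum>u\<in>{a, b} \<inter> {a..<b}. \<phi> u (next_in {a, b} u))" by simp
  also have "\<dots> \<le> (\<Sum>u\<in>A \<inter> {a..<b}. \<phi> u (next_in A u))"
    using A by (intro sum_next_in_mono[OF nonneg refl tri, where b=b]) auto
  finally show ?thesis .
qed

text \<open>The passage from finite sets to the indexed partitions behind the variation. One
  partition has to serve every \<open>\<phi>\<close>, hence the quantifier in the conclusion;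
  \<open>\<phi> u u = 0\<close> removes the degenerate cell at the largest point.\<close>

lemma sum_next_in_partition:
  fixes A :: "real set"
  assumes A: "finite A" "2 \<le> card A"
  obtains p n a b where "a < b" "interval_partition a b n p"
    "\<And>\<phi> :: real \<Rightarrow> real \<Rightarrow> real. (\<And>u. \<phi> u u = 0) \<Longrightarrow>
      (\<Sum>u\<in>A. \<phi> u (next_in A u)) = (\<Sum>i=1..n. \<phi> (p (i - 1)) (p i))"
proof -
  define l where "l = sorted_list_of_set A"
  define n where "n = card A - 1"
  define p where "p i = l ! i" for i
  have l: "length l = Suc n" "set l = A" "sorted_wrt (<) l"
    using A by (auto simp: l_def n_def)
  have less: "p i < p j \<longleftrightarrow> i < j" if "i \<le> n" "j \<le> n" for i j
    using l that sorted_wrt_nth_less[OF l(3), of i j] sorted_wrt_nth_less[OF l(3), of j i]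
    by (cases i j rule: linorder_cases) (auto simp: p_def)
  have A_eq: "A = p ` {..n}"
    using l by (auto simp: p_def set_conv_nth image_iff less_Suc_eq_le)
  have nxt: "next_in A (p i) = p (Suc i)" if "i < n" for i
    using that A less by (intro next_in_eqI) (auto simp: A_eq Suc_leI leD intro!: leI)
  have nxt_n: "next_in A (p n) = p n"
    by (intro next_in_top) (auto simp: A_eq less intro!: leI)
  have inj: "inj_on p {..n}"
    by (rule inj_onI) (metis atMost_iff less linorder_neqE_nat order_less_irrefl)
  have part: "interval_partition (p 0) (p n) n p" using less by (auto simp: interval_partition_def)
  have "0 < n" using A by (auto simp: n_def)
  then have "p 0 < p n" by (simp add: less)
  moreover have "(\<Sum>u\<in>A. \<phi> u (next_in A u)) = (\<Sum>i=1..n. \<phi> (p (i - 1)) (p i))"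
    if "\<And>u. \<phi> u u = 0" for \<phi> :: "real \<Rightarrow> real \<Rightarrow> real"
  proof -
    have "(\<Sum>u\<in>A. \<phi> u (next_in A u)) = (\<Sum>i\<le>n. \<phi> (p i) (next_in A (p i)))"
      unfolding A_eq by (subst sum.reindex[OF inj]) (simp add: A_eq)
    also have "\<dots> = (\<Sum>i<n. \<phi> (p i) (next_in A (p i)))"
      using that by (simp add: nxt_n flip: lessThan_Suc_atMost)
    also have "\<dots> = (\<Sum>i<n. \<phi> (p i) (p (Suc i)))"
      by (intro sum.cong) (auto simp: nxt)
    also have "\<dots> = (\<Sum>i=1..n. \<phi> (p (i - 1)) (p i))"
      by (rule sum.reindex_bij_witness[of _ "\<lambda>i. i - 1" Suc]) auto
    finally show ?thesis .
  qed
  ultimately show ?thesis using that part by blast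
qed

section \<open>Variation over finite grids\<close>

text \<open>Grids are finite sets rather than sequences, so that refinement is inclusion and limits
  along \<open>finite_subsets_at_top\<close> make sense. A cell is assigned to
  \<open>I \<times> J\<close> by its lower left corner, which makes the sum additive in
  \<open>I\<close> and in \<open>J\<close>.\<close>

definition grid_var ::
    "(real \<times> real \<Rightarrow> real) \<Rightarrow> real set \<Rightarrow> real set \<Rightarrow> real set \<Rightarrow> real set \<Rightarrow> real" where
  "grid_var f A B I J =
    (\<Sum>u\<in>A \<inter> I. \<Sum>v\<in>B \<inter> J. \<bar>rect_diff f u (next_in A u) v (next_in B v)\<bar>)"

lemma grid_var_nonneg: "0 \<le> grid_var f A B I J"
  by (auto simp: grid_var_def intro!: sum_nonneg)

lemma rect_diff_refl [simp]: "rect_diff f x x c d = 0" "rect_diff f a b y y = 0"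
  by (auto simp: rect_diff_def)

lemma rect_diff_triangle:
  "\<bar>rect_diff f u w c d\<bar> \<le> \<bar>rect_diff f u v c d\<bar> + \<bar>rect_diff f v w c d\<bar>"
  "\<bar>rect_diff f a b u w\<bar> \<le> \<bar>rect_diff f a b u v\<bar> + \<bar>rect_diff f a b v w\<bar>"
  by (auto simp: rect_diff_def)

lemma vitali_sum_le_variation:
  assumes "a < b" "c < d" "interval_partition a b n p" "interval_partition c d m q"
  shows "ereal (vitali_sum f n p m q) \<le> vitali_variation f"
proof -
  have "ereal (vitali_sum f n p m q) \<le> vitali_variation_on f a b c d"
    unfolding vitali_variation_on_def using assms by (intro Sup_upper) auto
  also have "\<dots> \<le> vitali_variation f"
    unfolding vitali_variation_def using assms by (intro Sup_upper) auto
  finally show ?thesis .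
qed

lemma sum_next_in_small_card:
  assumes "card A < 2" "finite A" "\<And>u. \<phi> u u = (0::real)"
  shows "(\<Sum>u\<in>A. \<phi> u (next_in A u)) = 0"
proof -
  consider "A = {}" | a where "A = {a}"
    using assms by (auto simp: card_1_singleton_iff less_2_cases_iff)
  then show ?thesis by cases (auto simp: next_in_def assms)
qed

lemma grid_var_eq_vitali_sum:
  assumes A: "finite A" "2 \<le> card A" and B: "finite B" "2 \<le> card B"
  obtains a b c d n p m q where "a < b" "c < d" "interval_partition a b n p"
    "interval_partition c d m q" "grid_var f A B UNIV UNIV = vitali_sum f n p m q"
proof -
  obtain p n a b where p: "a < b" "interval_partition a b n p"
    "\<And>\<phi> :: real \<Rightarrow> real \<Rightarrow> real. (\<And>u. \<phi> u u = 0) \<Longrightarrow>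
      (\<Sum>u\<in>A. \<phi> u (next_in A u)) = (\<Sum>i=1..n. \<phi> (p (i - 1)) (p i))"
    using sum_next_in_partition[OF A] by metis
  obtain q m c d where q: "c < d" "interval_partition c d m q"
    "\<And>\<phi> :: real \<Rightarrow> real \<Rightarrow> real. (\<And>u. \<phi> u u = 0) \<Longrightarrow>
      (\<Sum>u\<in>B. \<phi> u (next_in B u)) = (\<Sum>i=1..m. \<phi> (q (i - 1)) (q i))"
    using sum_next_in_partition[OF B] by metis
  have "grid_var f A B UNIV UNIV =
      (\<Sum>i=1..n. \<Sum>v\<in>B. \<bar>rect_diff f (p (i - 1)) (p i) v (next_in B v)\<bar>)"
    unfolding grid_var_def Int_UNIV_right
    by (rule p(3)[of "\<lambda>u u'. \<Sum>v\<in>B. \<bar>rect_diff f u u' v (next_in B v)\<bar>"]) simp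
  also have "\<dots> = vitali_sum f n p m q"
    unfolding vitali_sum_def
    by (intro sum.cong refl q(3)[of "\<lambda>v v'. \<bar>rect_diff f _ _ v v'\<bar>"]) simp
  finally show ?thesis using that p q by blast
qed

lemma grid_var_mono_sets:
  assumes "finite A" "finite B" "I \<subseteq> I'" "J \<subseteq> J'"
  shows "grid_var f A B I J \<le> grid_var f A B I' J'"
proof -
  have "grid_var f A B I J \<le> (\<Sum>u\<in>A \<inter> I. \<Sum>v\<in>B \<inter> J'. \<bar>rect_diff f u (next_in A u) v (next_in B v)\<bar>)"
    unfolding grid_var_def using assms by (intro sum_mono sum_mono2) auto
  also have "\<dots> \<le> grid_var f A B I' J'"
    unfolding grid_var_def using assms by (intro sum_mono2 sum_nonneg) auto
  finally show ?thesis .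
qed

lemma grid_var_bounded:
  assumes "f \<in> BV_Vitali"
  obtains V where "\<And>A B I J. finite A \<Longrightarrow> finite B \<Longrightarrow> grid_var f A B I J \<le> V"
proof -
  define V where "V = real_of_ereal (vitali_variation f)"
  have fin: "vitali_variation f < \<infinity>" using assms by (simp add: BV_Vitali_def)
  have V: "vitali_sum f n p m q \<le> V" if "a < b" "c < d" "interval_partition a b n p" "interval_partition c d m q"
    for a b c d n p m q
    using vitali_sum_le_variation[OF that, of f] fin unfolding V_def
    by (cases "vitali_variation f") auto
  \<comment> \<open>The absolute value also dominates the zero sums of grids with fewer than two
    points in some direction, to which no partition corresponds.\<close>
  have full: "grid_var f A B UNIV UNIV \<le> \<bar>V\<bar>" if "finite A" "finite B" for A B
  proof -
    consider "card A < 2" | "card B < 2" | "2 \<le> card A" "2 \<le> card B" by linarith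
    then show ?thesis
    proof cases
      case 1
      then show ?thesis unfolding grid_var_def Int_UNIV_right
        by (subst sum_next_in_small_card[of A "\<lambda>u u'. \<Sum>v\<in>B. \<bar>rect_diff f u u' v (next_in B v)\<bar>"])
           (use that in auto)
    next
      case 2
      have "(\<Sum>v\<in>B. \<bar>rect_diff f u u' v (next_in B v)\<bar>) = 0" for u u'
        by (rule sum_next_in_small_card[of B "\<lambda>v v'. \<bar>rect_diff f u u' v v'\<bar>"]) (use 2 that in auto)
      then show ?thesis unfolding grid_var_def Int_UNIV_right by simp
    next
      case 3
      then show ?thesis
        by (metis grid_var_eq_vitali_sum[OF that(1) 3(1) that(2) 3(2)] V abs_ge_self order_trans)
    qed
  qed
  have "grid_var f A B I J \<le> \<bar>V\<bar>" if "finite A" "finite B" for A B I J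
    using grid_var_mono_sets[OF that, of I UNIV J UNIV f] full[OF that] by simp
  then show ?thesis using that by blast
qed

text \<open>The coordinates are refined one after the other. With \<open>x\<close> in
  \<open>A\<close> and \<open>y\<close> in \<open>B\<close> no counted cell crosses the upper edges
  of the quadrant, so both halves of a split cell are still counted.\<close>

lemma grid_var_refine:
  assumes "finite A'" "A \<subseteq> A'" "x \<in> A" "finite B'" "B \<subseteq> B'" "y \<in> B"
  shows "grid_var f A B {..<x} {..<y} \<le> grid_var f A' B' {..<x} {..<y}"
proof -
  have finA: "finite A" using assms finite_subset by blast
  let ?\<phi> = "\<lambda>u u'. \<Sum>v\<in>B \<inter> {..<y}. \<bar>rect_diff f u u' v (next_in B v)\<bar>"
  have "(\<Sum>u\<in>A \<inter> {..<x}. ?\<phi> u (next_in A u)) \<le> (\<Sum>u\<in>A' \<inter> {..<x}. ?\<phi> u (next_in A' u))"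
    using assms rect_diff_triangle(1)[of f]
    by (intro sum_next_in_mono[where b = x and \<phi> = ?\<phi>])
       (auto intro!: sum_nonneg sum_mono simp flip: sum.distrib)
  also have "\<dots> \<le> grid_var f A' B' {..<x} {..<y}"
    unfolding grid_var_def
  proof (rule sum_mono)
    fix u assume "u \<in> A' \<inter> {..<x}"
    let ?\<psi> = "\<lambda>v v'. \<bar>rect_diff f u (next_in A' u) v v'\<bar>"
    show "(\<Sum>v\<in>B \<inter> {..<y}. ?\<psi> v (next_in B v)) \<le> (\<Sum>v\<in>B' \<inter> {..<y}. ?\<psi> v (next_in B' v))"
      using assms rect_diff_triangle(2)[of f]
      by (intro sum_next_in_mono[where b = y and \<phi> = ?\<psi>]) auto
  qed
  finally show ?thesis by (simp add: grid_var_def)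
qed

lemma grid_var_ge_rect_diff:
  assumes "finite A" "a \<in> A" "b \<in> A" "a \<le> b" "finite B" "c \<in> B" "d \<in> B" "c \<le> d"
  shows "\<bar>rect_diff f a b c d\<bar> \<le> grid_var f A B {a..<b} {c..<d}"
proof -
  let ?\<phi> = "\<lambda>u u'. \<bar>rect_diff f u u' c d\<bar>"
  have "?\<phi> a b \<le> (\<Sum>u\<in>A \<inter> {a..<b}. ?\<phi> u (next_in A u))"
    using assms rect_diff_triangle(1)[of f] by (intro sum_next_in_ge[where \<phi> = ?\<phi>]) auto
  also have "\<dots> \<le> grid_var f A B {a..<b} {c..<d}"
    unfolding grid_var_def
  proof (rule sum_mono)
    fix u assume "u \<in> A \<inter> {a..<b}"
    let ?\<psi> = "\<lambda>v v'. \<bar>rect_diff f u (next_in A u) v v'\<bar>"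
    show "?\<psi> c d \<le> (\<Sum>v\<in>B \<inter> {c..<d}. ?\<psi> v (next_in B v))"
      using assms rect_diff_triangle(2)[of f] by (intro sum_next_in_ge[where \<phi> = ?\<psi>]) auto
  qed
  finally show ?thesis .
qed

text \<open>Inclusion and exclusion for lower left corners: those in a half-open rectangle come from
  four quadrants. This exact identity is why the dominating function is built from
  quadrants.\<close>

lemma rect_diff_grid_var:
  assumes "finite A" "finite B" "a \<le> b" "c \<le> d"
  shows "rect_diff (\<lambda>(x, y). grid_var f A B {..<x} {..<y}) a b c d = grid_var f A B {a..<b} {c..<d}"
proof -
  have I: "A \<inter> {..<b} = A \<inter> {..<a} \<union> A \<inter> {a..<b}" using assms by auto
  have J: "B \<inter> {..<d} = B \<inter> {..<c} \<union> B \<inter> {c..<d}" using assms by auto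
  have sI: "sum g (A \<inter> {..<b}) = sum g (A \<inter> {..<a}) + sum g (A \<inter> {a..<b})" for g :: "real \<Rightarrow> real"
    unfolding I using assms by (intro sum.union_disjoint) auto
  have sJ: "sum g (B \<inter> {..<d}) = sum g (B \<inter> {..<c}) + sum g (B \<inter> {c..<d})" for g :: "real \<Rightarrow> real"
    unfolding J using assms by (intro sum.union_disjoint) auto
  show ?thesis by (simp add: rect_diff_def grid_var_def sI sJ sum.distrib)
qed

text \<open>\<open>P (x, y)\<close> is the variation of f over the quadrant below
  \<open>(x, y)\<close>. A supremum does not commute with the differences in
  \<open>rect_diff\<close>, but a limit does. So \<open>P\<close> is shown to be the limit of
  \<open>g\<close> along the finite sets, and each claim passes to the limit from a fixed
  grid.\<close>

lemma BV_Vitali_dominating: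
  assumes "f \<in> BV_Vitali"
  obtains P V where "\<And>x y. 0 \<le> P (x, y)" "\<And>x y. P (x, y) \<le> V"
    "\<And>x x' y y'. x \<le> x' \<Longrightarrow> y \<le> y' \<Longrightarrow> P (x, y) \<le> P (x', y')"
    "\<And>a b c d. a \<le> b \<Longrightarrow> c \<le> d \<Longrightarrow> \<bar>rect_diff f a b c d\<bar> \<le> rect_diff P a b c d"
proof -
  obtain V where V: "\<And>A B I J. finite A \<Longrightarrow> finite B \<Longrightarrow> grid_var f A B I J \<le> V"
    using grid_var_bounded[OF assms] by blast
  let ?F = "finite_subsets_at_top (UNIV :: real set)"
  \<comment> \<open>The same set \<open>C\<close> in both coordinates leaves a single directed index
    set.\<close>
  define g where "g C x y = grid_var f C C {..<x} {..<y}" for C x y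
  \<comment> \<open>Only grids through \<open>x\<close> and \<open>y\<close> compete: among them
    refinement increases \<open>g\<close>.\<close>
  define P where "P = (\<lambda>(x, y). SUP C\<in>{C. finite C \<and> x \<in> C \<and> y \<in> C}. g C x y)"
  have lim: "((\<lambda>C. g C x y) \<longlongrightarrow> P (x, y)) ?F" for x y
  proof -
    let ?S = "{C. finite C \<and> x \<in> C \<and> y \<in> C}"
    have bdd: "bdd_above ((\<lambda>C. g C x y) ` ?S)"
      by (rule bdd_aboveI[of _ V]) (auto simp: g_def V)
    have ne: "{x, y} \<in> ?S" by simp
    show ?thesis
    proof (rule order_tendstoI)
      fix e assume "e < P (x, y)"
      then have "e < (SUP C\<in>?S. g C x y)" by (simp add: P_def)
      then obtain C where C: "C \<in> ?S" "e < g C x y"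
        by (subst (asm) less_cSUP_iff[OF _ bdd]) (use ne in blast)+
      have "e < g C' x y" if "finite C'" "C \<subseteq> C'" for C'
        using C that grid_var_refine[of C' C x C' C y f] by (auto simp: g_def)
      then show "\<forall>\<^sub>F C in ?F. e < g C x y"
        using C by (auto simp: eventually_finite_subsets_at_top intro!: exI[of _ C])
    next
      fix e assume e: "P (x, y) < e"
      have "g C x y < e" if "C \<in> ?S" for C
        using cSUP_upper[OF that bdd] e by (auto simp: P_def)
      then show "\<forall>\<^sub>F C in ?F. g C x y < e"
        by (auto simp: eventually_finite_subsets_at_top intro!: exI[of _ "{x, y}"])
    qed
  qed
  have ev: "\<forall>\<^sub>F C in ?F. finite C \<and> S \<subseteq> C" if "finite S" for S
    using that by (auto simp: eventually_finite_subsets_at_top intro!: exI[of _ S])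
  have ntriv: "?F \<noteq> bot" by (rule finite_subsets_at_top_neq_bot)
  show ?thesis
  proof (rule that[of P V])
    show "0 \<le> P (x, y)" for x y
      by (rule tendsto_lowerbound[OF lim _ ntriv]) (simp add: g_def grid_var_nonneg)
    show "P (x, y) \<le> V" for x y
      by (rule tendsto_upperbound[OF lim _ ntriv])
         (use ev[of "{}"] in \<open>auto simp: g_def V elim: eventually_mono\<close>)
    show "P (x, y) \<le> P (x', y')" if "x \<le> x'" "y \<le> y'" for x x' y y'
      by (rule tendsto_le[OF ntriv lim lim])
         (use ev[of "{}"] that in \<open>auto simp: g_def intro!: grid_var_mono_sets elim!: eventually_mono\<close>)
    show "\<bar>rect_diff f a b c d\<bar> \<le> rect_diff P a b c d" if "a \<le> b" "c \<le> d" for a b c d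
    proof (rule tendsto_lowerbound[OF _ _ ntriv])
      show "((\<lambda>C. rect_diff (\<lambda>(x, y). g C x y) a b c d) \<longlongrightarrow> rect_diff P a b c d) ?F"
        unfolding rect_diff_def by (auto intro!: tendsto_intros lim)
      show "\<forall>\<^sub>F C in ?F. \<bar>rect_diff f a b c d\<bar> \<le> rect_diff (\<lambda>(x, y). g C x y) a b c d"
        using ev[of "{a, b, c, d}"] unfolding g_def
        by (rule eventually_rev_mp[OF _ always_eventually])
           (use that in \<open>auto simp: rect_diff_grid_var intro!: grid_var_ge_rect_diff\<close>)
    qed
  qed
qed

text \<open>A Stieltjes distribution function that need not be continuous from either side.\<close>

definition distribution_like :: "(real \<times> real \<Rightarrow> real) \<Rightarrow> bool" where
  "distribution_like G \<longleftrightarrow>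
    (\<forall>a b c d. a \<le> b \<longrightarrow> c \<le> d \<longrightarrow> 0 \<le> rect_diff G a b c d) \<and>
    (\<forall>y. ((\<lambda>x. G (x, y)) \<longlongrightarrow> 0) at_bot) \<and> (\<forall>x. ((\<lambda>y. G (x, y)) \<longlongrightarrow> 0) at_bot) \<and>
    (\<exists>M. \<forall>p. G p \<le> M)"

section \<open>Normalisation at minus infinity\<close>

lemma at_bot_tendsto_INF:
  fixes g :: "real \<Rightarrow> real"
  assumes "mono g" "\<And>x. m \<le> g x"
  shows "(g \<longlongrightarrow> (INF x. g x)) at_bot"
proof (rule order_tendstoI)
  have bdd: "bdd_below (range g)" using assms by (intro bdd_belowI[of _ m]) auto
  show "\<forall>\<^sub>F x in at_bot. e < g x" if "e < (INF x. g x)" for e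
    using that cINF_lower[OF bdd] by (auto intro!: always_eventually dest: less_le_trans)
  show "\<forall>\<^sub>F x in at_bot. g x < e" if e: "(INF x. g x) < e" for e
  proof -
    obtain x0 where "g x0 < e" using cINF_less_iff[of UNIV g e] e bdd by auto
    then have "g x < e" if "x \<le> x0" for x using monoD[OF \<open>mono g\<close> that] by simp
    then show ?thesis by (rule eventually_mono[OF eventually_le_at_bot])
  qed
qed

lemma filterlim_Pair_at_infinity:
  assumes "filterlim g at_infinity F"
  shows "filterlim (\<lambda>x. (g x, h x)) at_infinity F" "filterlim (\<lambda>x. (h x, g x)) at_infinity F"
proof -
  have *: "filterlim (\<lambda>x. norm (g x)) at_top F"
    using assms by (rule filterlim_at_infinity_imp_norm_at_top)
  show "filterlim (\<lambda>x. (g x, h x)) at_infinity F" "filterlim (\<lambda>x. (h x, g x)) at_infinity F"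
    by (auto intro!: filterlim_norm_at_top_imp_at_infinity filterlim_at_top_mono[OF *] always_eventually
        simp: norm_Pair)
qed

lemma BV_norm0_Jordan:
  assumes "f \<in> BV_norm0"
  obtains G H where "distribution_like G" "distribution_like H" "\<And>p. f p = G p - H p"
proof -
  have f0: "(f \<longlongrightarrow> 0) at_infinity" and "f \<in> BV_Vitali" using assms by (auto simp: BV_norm0_def)
  then obtain P V where P: "\<And>x y. 0 \<le> P (x, y)" "\<And>x y. P (x, y) \<le> V"
    "\<And>x x' y y'. x \<le> x' \<Longrightarrow> y \<le> y' \<Longrightarrow> P (x, y) \<le> P (x', y')"
    "\<And>a b c d. a \<le> b \<Longrightarrow> c \<le> d \<Longrightarrow> \<bar>rect_diff f a b c d\<bar> \<le> rect_diff P a b c d"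
    using BV_Vitali_dominating by metis
  define A where "A y = (INF x. P (x, y))" for y
  define B where "B x = (INF y. P (x, y))" for x
  define c where "c = (INF p. P p)"
  have bdd: "bdd_below (range P)" "bdd_below (range (\<lambda>x. P (x, y)))" "bdd_below (range (\<lambda>y. P (x, y)))"
    "bdd_below (range A)" "bdd_below (range B)" for x y
    using P(1) by (auto intro!: bdd_belowI[of _ 0] cINF_greatest simp: A_def B_def)
  have limA: "((\<lambda>x. P (x, y)) \<longlongrightarrow> A y) at_bot" for y
    unfolding A_def using P by (intro at_bot_tendsto_INF[of _ 0] monoI) auto
  have limB: "((\<lambda>y. P (x, y)) \<longlongrightarrow> B x) at_bot" for x
    unfolding B_def using P by (intro at_bot_tendsto_INF[of _ 0] monoI) auto
  have nonnegA: "0 \<le> A y" and nonnegB: "0 \<le> B x" for x y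
    using P by (auto simp: A_def B_def intro!: cINF_greatest)
  have "A y \<le> A y'" if "y \<le> y'" for y y'
    unfolding A_def using that by (intro cINF_mono bdd) (auto intro: P(3))
  then have "(A \<longlongrightarrow> (INF y. A y)) at_bot"
    using nonnegA by (intro at_bot_tendsto_INF[of _ 0] monoI) auto
  also have "(INF y. A y) = c"
    unfolding c_def
  proof (intro antisym cINF_greatest)
    fix p
    have "A (snd p) \<le> P p"
      unfolding A_def using cINF_lower[OF bdd(2), of "fst p"] by (cases p) simp
    then show "(INF y. A y) \<le> P p"
      using cINF_lower[OF bdd(4), of "snd p"] by simp
  next
    fix y
    show "(INF p. P p) \<le> A y"
      unfolding A_def by (rule cINF_greatest) (auto intro: cINF_lower[OF bdd(1)])
  qed auto
  finally have limA': "(A \<longlongrightarrow> c) at_bot" .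
  have "B y \<le> B y'" if "y \<le> y'" for y y'
    unfolding B_def using that by (intro cINF_mono bdd) (auto intro: P(3))
  then have "(B \<longlongrightarrow> (INF y. B y)) at_bot"
    using nonnegB by (intro at_bot_tendsto_INF[of _ 0] monoI) auto
  also have "(INF y. B y) = c"
    unfolding c_def
  proof (intro antisym cINF_greatest)
    fix p
    have "B (fst p) \<le> P p"
      unfolding B_def using cINF_lower[OF bdd(3), of "snd p"] by (cases p) simp
    then show "(INF y. B y) \<le> P p"
      using cINF_lower[OF bdd(5), of "fst p"] by simp
  next
    fix y
    show "(INF p. P p) \<le> B y"
      unfolding B_def by (rule cINF_greatest) (auto intro: cINF_lower[OF bdd(1)])
  qed auto
  finally have limB': "(B \<longlongrightarrow> c) at_bot" .
  \<comment> \<open>Functions of one coordinate do not affect rectangle increments. \<open>A\<close>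
    and \<open>B\<close> are the limits of \<open>P\<close> at the left and lower edges and
    \<open>c\<close> is their common limit, so \<open>G\<close> vanishes at both edges, and
    \<open>H\<close> does so because f does.\<close>
  define G where "G = (\<lambda>(x, y). P (x, y) - A y - B x + c)"
  define H where "H p = G p - f p" for p
  have rdG: "rect_diff G a b s t = rect_diff P a b s t" for a b s t
    by (simp add: rect_diff_def G_def)
  have rdH: "rect_diff H a b s t = rect_diff P a b s t - rect_diff f a b s t" for a b s t
    unfolding rdG[symmetric] by (simp add: rect_diff_def H_def)
  have limG: "((\<lambda>x. G (x, y)) \<longlongrightarrow> 0) at_bot" "((\<lambda>y. G (x, y)) \<longlongrightarrow> 0) at_bot" for x y
    unfolding G_def prod.case by (rule tendsto_eq_intros limA limB limA' limB' refl | simp)+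
  have limf: "((\<lambda>x. f (x, y)) \<longlongrightarrow> 0) at_bot" "((\<lambda>y. f (x, y)) \<longlongrightarrow> 0) at_bot" for x y
    by (rule filterlim_compose[OF f0] filterlim_Pair_at_infinity filterlim_at_bot_imp_at_infinity filterlim_ident)+
  have limH: "((\<lambda>x. H (x, y)) \<longlongrightarrow> 0) at_bot" "((\<lambda>y. H (x, y)) \<longlongrightarrow> 0) at_bot" for x y
    using tendsto_diff[OF limG(1) limf(1)] tendsto_diff[OF limG(2) limf(2)] by (auto simp: H_def)
  \<comment> \<open>\<open>K (x, y)\<close> is recovered by sending the lower and then the left edge
    of a rectangle to minus infinity. The increments of \<open>P\<close> are at most
    \<open>2 * V\<close> because \<open>P\<close> lies between 0 and \<open>V\<close>; those of
    \<open>K\<close> are at most twice as large.\<close>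
  have bound: "K (x, y) \<le> 4 * V"
    if K: "\<And>a b c d. a \<le> b \<Longrightarrow> c \<le> d \<Longrightarrow> rect_diff K a b c d \<le> 2 * rect_diff P a b c d"
      "\<And>y. ((\<lambda>x. K (x, y)) \<longlongrightarrow> 0) at_bot" "\<And>x. ((\<lambda>y. K (x, y)) \<longlongrightarrow> 0) at_bot" for K x y
  proof -
    have PP: "rect_diff P a b c d \<le> 2 * V" for a b c d
      using P(1)[of a d] P(1)[of b c] P(2)[of b d] P(2)[of a c] by (simp add: rect_diff_def)
    have "K (x, y) - K (a, y) \<le> 4 * V" if "a \<le> x" for a
    proof (rule tendsto_upperbound[where F = at_bot and f = "\<lambda>c. rect_diff K a x c y"])
      show "((\<lambda>c. rect_diff K a x c y) \<longlongrightarrow> K (x, y) - K (a, y)) at_bot"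
        using tendsto_add[OF tendsto_diff[OF tendsto_const K(3)[of x]] K(3)[of a], of "K (x, y) - K (a, y)"]
        by (simp add: rect_diff_def)
      show "\<forall>\<^sub>F c in at_bot. rect_diff K a x c y \<le> 4 * V"
      proof (rule eventually_mono[OF eventually_le_at_bot[of y]])
        show "rect_diff K a x c y \<le> 4 * V" if "c \<le> y" for c
          using K(1)[OF \<open>a \<le> x\<close> that] PP[of a x c y] by simp
      qed
    qed simp
    moreover have "((\<lambda>a. K (x, y) - K (a, y)) \<longlongrightarrow> K (x, y)) at_bot"
      using tendsto_diff[OF tendsto_const K(2)[of y], of "K (x, y)"] by simp
    ultimately show ?thesis
      by (intro tendsto_upperbound[where F = at_bot and f = "\<lambda>a. K (x, y) - K (a, y)"])
         (simp_all add: eventually_mono[OF eventually_le_at_bot[of x]])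
  qed
  have "distribution_like K" if K: "\<And>a b c d. a \<le> b \<Longrightarrow> c \<le> d \<Longrightarrow> 0 \<le> rect_diff K a b c d \<and> rect_diff K a b c d \<le> 2 * rect_diff P a b c d"
      "\<And>y. ((\<lambda>x. K (x, y)) \<longlongrightarrow> 0) at_bot" "\<And>x. ((\<lambda>y. K (x, y)) \<longlongrightarrow> 0) at_bot" for K
    using bound[of K] K unfolding distribution_like_def by (auto intro!: exI[of _ "4 * V"])
  moreover have "0 \<le> rect_diff K a b c d \<and> rect_diff K a b c d \<le> 2 * rect_diff P a b c d"
    if "a \<le> b" "c \<le> d" "K = G \<or> K = H" for a b c d K
    using P(4)[OF that(1,2)] that(3) by (auto simp: rdG rdH)
  ultimately show ?thesis
    using limG limH by (intro that[of G H]) (auto simp: H_def)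
qed

subsection \<open>Representing measures\<close>

lemma distribution_likeD:
  assumes "distribution_like G"
  shows "\<And>a b c d. a \<le> b \<Longrightarrow> c \<le> d \<Longrightarrow> 0 \<le> rect_diff G a b c d"
    "\<And>y. ((\<lambda>x. G (x, y)) \<longlongrightarrow> 0) at_bot" "\<And>x. ((\<lambda>y. G (x, y)) \<longlongrightarrow> 0) at_bot"
    "\<exists>M. \<forall>p. G p \<le> M"
  using assms by (auto simp: distribution_like_def)

text \<open>The difference is a limit of nonnegative increments over rectangles whose lower edge
  goes to minus infinity.\<close>

lemma distribution_like_mono1:
  assumes "distribution_like G" "x \<le> x'"
  shows "G (x, y) \<le> G (x', y)"
proof -
  note G = distribution_likeD[OF assms(1)]
  have "((\<lambda>c. rect_diff G x x' c y) \<longlongrightarrow> G (x', y) - G (x, y)) at_bot"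
    using tendsto_add[OF tendsto_diff[OF tendsto_const G(3)[of x']] G(3)[of x], of "G (x', y) - G (x, y)"]
    by (simp add: rect_diff_def)
  moreover have "\<forall>\<^sub>F c in at_bot. 0 \<le> rect_diff G x x' c y"
    by (rule eventually_mono[OF eventually_le_at_bot[of y]]) (use G(1) assms in auto)
  ultimately have "0 \<le> G (x', y) - G (x, y)" by (rule tendsto_lowerbound) simp
  then show ?thesis by simp
qed

lemma distribution_like_mono2:
  assumes "distribution_like G" "y \<le> y'"
  shows "G (x, y) \<le> G (x, y')"
proof -
  note G = distribution_likeD[OF assms(1)]
  have "((\<lambda>a. rect_diff G a x y y') \<longlongrightarrow> G (x, y') - G (x, y)) at_bot"
    using tendsto_add[OF tendsto_diff[OF tendsto_const G(2)[of y']] G(2)[of y], of "G (x, y') - G (x, y)"]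
    by (simp add: rect_diff_def algebra_simps)
  moreover have "\<forall>\<^sub>F a in at_bot. 0 \<le> rect_diff G a x y y'"
    by (rule eventually_mono[OF eventually_le_at_bot[of x]]) (use G(1) assms in auto)
  ultimately have "0 \<le> G (x, y') - G (x, y)" by (rule tendsto_lowerbound) simp
  then show ?thesis by simp
qed

lemma distribution_like_mono:
  assumes "distribution_like G" "x \<le> x'" "y \<le> y'"
  shows "G (x, y) \<le> G (x', y')"
  using distribution_like_mono1[OF assms(1,2), of y] distribution_like_mono2[OF assms(1,3), of x'] by simp

lemma distribution_like_nonneg:
  assumes "distribution_like G"
  shows "0 \<le> G (x, y)"
proof (rule tendsto_upperbound[OF distribution_likeD(2)[OF assms, of y]])
  show "\<forall>\<^sub>F x' in at_bot. G (x', y) \<le> G (x, y)"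
    by (rule eventually_mono[OF eventually_le_at_bot[of x]]) (rule distribution_like_mono1[OF assms])
qed simp

lemma at_top_tendsto_SUP:
  fixes g :: "real \<Rightarrow> real"
  assumes "mono g" "\<And>x. g x \<le> M"
  shows "(g \<longlongrightarrow> (SUP x. g x)) at_top"
proof (rule order_tendstoI)
  have bdd: "bdd_above (range g)" using assms by (intro bdd_aboveI[of _ M]) auto
  show "\<forall>\<^sub>F x in at_top. g x < e" if "(SUP x. g x) < e" for e
    using that cSUP_upper[OF _ bdd] by (auto intro!: always_eventually intro: le_less_trans)
  show "\<forall>\<^sub>F x in at_top. e < g x" if e: "e < (SUP x. g x)" for e
  proof -
    obtain x0 where "e < g x0" using less_cSUP_iff[of UNIV g e] e bdd by auto
    then have "e < g x" if "x0 \<le> x" for x using monoD[OF \<open>mono g\<close> that] by simp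
    then show ?thesis by (rule eventually_mono[OF eventually_ge_at_top])
  qed
qed

section \<open>Stieltjes measures on the line and their comparison\<close>

lemma stieltjes_measure_exists:
  fixes g :: "real \<Rightarrow> real"
  assumes g: "mono g" "(g \<longlongrightarrow> 0) at_bot" "\<And>x. g x \<le> M"
  obtains m where "finite_borel_measure m" "\<And>x. (g \<longlongrightarrow> cdf m x) (at_right x)"
proof -
  \<comment> \<open>The right-continuous version of \<open>g\<close>, as
    \<open>interval_measure\<close> requires.\<close>
  define F where "F x = (INF s\<in>{x<..}. g s)" for x
  have nonneg: "0 \<le> g x" for x
    by (rule tendsto_upperbound[OF g(2)])
       (auto intro: eventually_mono[OF eventually_le_at_bot[of x]] monoD[OF g(1)])
  have bdd: "bdd_below (g ` S)" for S by (rule bdd_belowI[of _ 0]) (auto simp: nonneg)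
  have gF: "g x \<le> F x" for x
    unfolding F_def by (rule cINF_greatest) (auto intro: monoD[OF g(1)])
  have Fg: "F x \<le> g s" if "x < s" for x s
    unfolding F_def using that by (intro cINF_lower bdd) auto
  have monoF: "F x \<le> F y" if "x \<le> y" for x y
    unfolding F_def using that by (intro cINF_superset_mono bdd) auto
  have below: "\<exists>s>x. g s < e" if e: "F x < e" for x e
    using cINF_less_iff[OF _ bdd, of "{x<..}" e] e unfolding F_def by auto
  have lim: "(g \<longlongrightarrow> F x) (at_right x)" for x
  proof (rule order_tendstoI)
    fix e assume "e < F x"
    then have "e < g s" if "x < s" for s using Fg[OF that] by simp
    then show "\<forall>\<^sub>F s in at_right x. e < g s" by (simp add: eventually_at_filter)
  next
    fix e assume "F x < e"
    then obtain s where "x < s" "g s < e" using below by blast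
    then have "g t < e" if "t < s" for t using monoD[OF g(1), of t s] that by simp
    then show "\<forall>\<^sub>F s in at_right x. g s < e"
      using \<open>x < s\<close> by (auto simp: eventually_at_right_field)
  qed
  have cont: "continuous (at_right x) F" for x
    unfolding continuous_within
  proof (rule order_tendstoI)
    fix e assume "e < F x"
    then have "e < F s" if "x < s" for s using monoF[of x s] that by simp
    then show "\<forall>\<^sub>F s in at_right x. e < F s" by (simp add: eventually_at_filter)
  next
    fix e assume "F x < e"
    then obtain s where "x < s" "g s < e" using below by blast
    then have "F t < e" if "t < s" for t using Fg[of t s] that by simp
    then show "\<forall>\<^sub>F s in at_right x. F s < e"
      using \<open>x < s\<close> by (auto simp: eventually_at_right_field)
  qed
  have bot: "(F \<longlongrightarrow> 0) at_bot"
  proof (rule tendsto_sandwich[OF _ _ tendsto_const filterlim_compose[OF g(2)]])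
    \<comment> \<open>The shift by 1 comes from \<open>F x \<le> g (x + 1)\<close>.\<close>
    show "filterlim (\<lambda>x::real. x + 1) at_bot at_bot"
      using filterlim_tendsto_add_at_bot_iff[OF tendsto_const[of 1], of "\<lambda>x::real. x" at_bot]
      by (simp add: add.commute filterlim_ident)
  qed (auto intro!: always_eventually Fg order_trans[OF nonneg gF])
  have FM: "F x \<le> M" for x using Fg[of x "x + 1"] g(3)[of "x + 1"] by simp
  have top: "(F \<longlongrightarrow> (SUP x. F x)) at_top"
    using monoF FM by (intro at_top_tendsto_SUP monoI) auto
  have "0 \<le> (SUP x. F x)"
    using FM order_trans[OF nonneg gF] by (intro cSUP_upper2[where x = 0] bdd_aboveI[of _ M]) auto
  then have "finite_borel_measure (interval_measure F)" "cdf (interval_measure F) = F"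
    using finite_borel_measure_interval_measure[OF monoF cont bot top]
      cdf_interval_measure[OF monoF cont bot] by auto
  then show ?thesis using that[of "interval_measure F"] lim by metis
qed

text \<open>At jumps of \<open>g\<close> the measure is known only up to these inequalities. Open
  rays are used because they lead to the open quadrants in \<open>represents\<close>.\<close>

lemma stieltjes_measure_lessThan:
  fixes g :: "real \<Rightarrow> real"
  assumes g: "mono g" and m: "finite_borel_measure m" "\<And>x. (g \<longlongrightarrow> cdf m x) (at_right x)"
  shows "measure m {..<x} \<le> g x" "s < x \<Longrightarrow> g s \<le> measure m {..<x}"
proof -
  interpret m: finite_borel_measure m by fact
  have 1: "cdf m t \<le> g x" if "t < x" for t x
    by (rule tendsto_upperbound[OF m(2)])
       (use that in \<open>auto simp: eventually_at_right_field intro!: exI[of _ x] monoD[OF g]\<close>)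
  show "measure m {..<x} \<le> g x"
    by (rule tendsto_upperbound[OF m.cdf_at_left])
       (use 1 in \<open>auto simp: eventually_at_filter\<close>)
  show "g s \<le> measure m {..<x}" if "s < x"
  proof -
    have "g s \<le> cdf m s"
      by (rule tendsto_lowerbound[OF m(2)])
         (auto simp: eventually_at_filter intro!: always_eventually monoD[OF g])
    also have "\<dots> \<le> measure m {..<x}"
      unfolding cdf_def using that by (intro m.finite_measure_mono) (auto simp: m.M_is_borel)
    finally show ?thesis .
  qed
qed

text \<open>Serves to compare Stieltjes measures on all Borel sets: if the difference of two
  distribution functions is monotone, it generates a third measure, and additivity turns this into a
  setwise inequality.\<close>

lemma emeasure_eq_add_of_cdf:
  assumes "finite_borel_measure R" "finite_borel_measure M" "finite_borel_measure N"
    and cdf: "\<And>x. cdf R x = cdf M x + cdf N x" and A: "A \<in> sets borel"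
  shows "emeasure R A = emeasure M A + emeasure N A"
proof -
  interpret M: finite_borel_measure M by fact
  interpret N: finite_borel_measure N by fact
  define S where "S = measure_of UNIV (sets borel) (\<lambda>A. emeasure M A + emeasure N A)"
  have sets: "sets S = sets borel"
    unfolding S_def using sets.sigma_sets_eq[of "borel :: real measure"] by simp
  have S: "emeasure S A = emeasure M A + emeasure N A" if "A \<in> sets borel" for A
  proof (rule emeasure_measure_of[OF S_def])
    show "countably_additive (sets S) (\<lambda>A. emeasure M A + emeasure N A)"
      unfolding countably_additive_def sets
    proof safe
      fix X :: "nat \<Rightarrow> real set" assume X: "range X \<subseteq> sets borel" "disjoint_family X"
      show "(\<Sum>i. emeasure M (X i) + emeasure N (X i)) = emeasure M (\<Union> (range X)) + emeasure N (\<Union> (range X))"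
        using X by (subst suminf_add[symmetric]) (auto simp: suminf_emeasure M.M_is_borel N.M_is_borel)
    qed
  qed (use that in \<open>auto simp: sets positive_def\<close>)
  have "emeasure S (space S) \<noteq> \<infinity>"
    using S[of UNIV] sets_eq_imp_space_eq[OF sets] M.emeasure_finite N.emeasure_finite by auto
  then have fS: "finite_borel_measure S"
    using sets by (intro finite_borel_measure.intro finite_measureI finite_borel_measure_axioms.intro)
  interpret S: finite_borel_measure S by fact
  have "cdf S = cdf R"
  proof
    fix x
    have "cdf S x = cdf M x + cdf N x"
      unfolding cdf_def measure_def using S[of "{..x}"] M.emeasure_finite N.emeasure_finite
      by (auto simp: less_top[symmetric] intro!: enn2real_plus)
    then show "cdf S x = cdf R x" by (simp add: cdf)
  qed
  with cdf_unique'[OF fS assms(1)] have "S = R" by simp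
  then show ?thesis using S[OF A] by simp
qed

text \<open>On the set where \<open>g < f\<close> the hypothesis meets the reverse inequality, so
  there both densities define the same finite measure and agree almost everywhere; hence the set is
  null.\<close>

lemma AE_le_of_density_le:
  assumes "finite_measure M" and f: "f \<in> borel_measurable M" and g: "g \<in> borel_measurable M"
    and fin: "(\<integral>\<^sup>+x. g x \<partial>M) < \<infinity>"
    and le: "\<And>A. A \<in> sets M \<Longrightarrow> emeasure (density M f) A \<le> emeasure (density M g) A"
  shows "AE x in M. f x \<le> (g x :: ennreal)"
proof -
  note [measurable] = f g
  define A where "A = {x \<in> space M. g x < f x}"
  have A [measurable]: "A \<in> sets M" unfolding A_def by measurable
  have "(AE x in M. f x * indicator A x = g x * indicator A x)"
  proof (rule finite_density_unique[THEN iffD1])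
    show "density M (\<lambda>x. f x * indicator A x) = density M (\<lambda>x. g x * indicator A x)"
    proof (rule measure_eqI)
      fix B assume "B \<in> sets (density M (\<lambda>x. f x * indicator A x))"
      then have B [measurable]: "B \<in> sets M" by simp
      have "emeasure (density M f) (A \<inter> B) = emeasure (density M g) (A \<inter> B)"
      proof (rule antisym)
        show "emeasure (density M g) (A \<inter> B) \<le> emeasure (density M f) (A \<inter> B)"
          by (auto simp: emeasure_density A_def intro!: nn_integral_mono split: split_indicator)
      qed (rule le, simp)
      then show "emeasure (density M (\<lambda>x. f x * indicator A x)) B = emeasure (density M (\<lambda>x. g x * indicator A x)) B"
        by (simp add: emeasure_density indicator_inter_arith mult.assoc)
    qed simp
    have "(\<integral>\<^sup>+x. f x * indicator A x \<partial>M) = emeasure (density M f) A"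
      by (simp add: emeasure_density)
    also have "\<dots> \<le> emeasure (density M g) A" by (rule le) simp
    also have "\<dots> \<le> (\<integral>\<^sup>+x. g x \<partial>M)"
      by (auto simp: emeasure_density intro!: nn_integral_mono split: split_indicator)
    finally show "(\<integral>\<^sup>+x. f x * indicator A x \<partial>M) \<noteq> \<infinity>" using fin by (simp add: top_unique)
  qed auto
  with AE_space show ?thesis
    by eventually_elim (auto simp: A_def not_less split: split_indicator_asm)
qed

section \<open>Planar measures from quadrant values\<close>

definition quadrant :: "real \<Rightarrow> real \<Rightarrow> (real \<times> real) set" where
  "quadrant x y = {..<x} \<times> {..<y}"

text \<open>The inequalities pin down \<open>N\<close> although \<open>G\<close> may take any intermediate value at its jumps.\<close>

definition represents :: "(real \<times> real) measure \<Rightarrow> (real \<times> real \<Rightarrow> real) \<Rightarrow> bool" where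
  "represents N G \<longleftrightarrow> finite_measure N \<and> sets N = sets borel \<and>
    (\<forall>x y. measure N (quadrant x y) \<le> G (x, y) \<and>
       (\<forall>s<x. \<forall>t<y. G (s, t) \<le> measure N (quadrant x y)))"

text \<open>Disintegration: \<open>m\<close> is the first marginal of the measure to be constructed, and \<open>h q u\<close> is the
  conditional probability, given the first coordinate \<open>u\<close>, that the second one is at most \<open>q\<close>.\<close>

lemma mono_densities:
  fixes G :: "real \<times> real \<Rightarrow> real"
  assumes G: "distribution_like G"
  obtains m :: "real measure" and h :: "rat \<Rightarrow> real \<Rightarrow> real"
  where "finite_borel_measure m" "\<And>q. h q \<in> borel_measurable borel"
    "\<And>q u. 0 \<le> h q u" "\<And>q u. h q u \<le> 1" "\<And>q r u. q \<le> r \<Longrightarrow> h q u \<le> h r u"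
    "\<And>q x. (\<integral>\<^sup>+u. ennreal (h q u) * indicator {..<x} u \<partial>m) \<le> ennreal (G (x, of_rat q))"
    "\<And>q s x. s < x \<Longrightarrow> ennreal (G (s, of_rat q)) \<le> (\<integral>\<^sup>+u. ennreal (h q u) * indicator {..<x} u \<partial>m)"
    "\<And>x e. 0 < e \<Longrightarrow> \<exists>q s. s < x \<and> measure m {..<x} < G (s, of_rat q) + e"
proof -
  note mono = distribution_like_mono[OF G] and nonneg = distribution_like_nonneg[OF G]
  obtain M where M: "\<And>p. G p \<le> M" using distribution_likeD(4)[OF G] by auto
  \<comment> \<open>The limit of \<open>G (x, y)\<close> as \<open>y\<close> grows. By monotonicity
    rational heights give the full supremum, and their countability will collect all exceptional
    null sets into one.\<close>
  define G1 where "G1 x = (SUP q::rat. G (x, of_rat q))" for x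
  have bdd: "bdd_above (range (\<lambda>q::rat. G (x, of_rat q)))" for x
    by (rule bdd_aboveI[of _ M]) (auto simp: M)
  have G1_ge: "G (x, of_rat q) \<le> G1 x" for x and q :: rat
    unfolding G1_def by (rule cSUP_upper[OF _ bdd]) simp
  have G1_le: "G1 x \<le> M" for x unfolding G1_def by (rule cSUP_least) (auto simp: M)
  \<comment> \<open>The part of \<open>G1\<close> above height \<open>of_rat q\<close> increases
    with \<open>x\<close>, since rectangle increments are nonnegative. In terms of measures this
    becomes \<open>n_le_m\<close>.\<close>
  have dG1: "G1 x - G (x, of_rat q) \<le> G1 x' - G (x', of_rat q)" if "x \<le> x'" for x x' and q :: rat
  proof -
    have "G (x, of_rat r) \<le> G1 x' - G (x', of_rat q) + G (x, of_rat q)" for r :: rat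
    proof (cases "q \<le> r")
      case True
      then have "0 \<le> rect_diff G x x' (of_rat q) (of_rat r)"
        using that by (intro distribution_likeD(1)[OF G]) (auto simp: of_rat_less_eq)
      then show ?thesis using G1_ge[of x' r] by (simp add: rect_diff_def)
    next
      case False
      then have "G (x, of_rat r) \<le> G (x, of_rat q)" by (intro mono) (auto simp: of_rat_less_eq)
      then show ?thesis using G1_ge[of x' q] by simp
    qed
    then have "G1 x \<le> G1 x' - G (x', of_rat q) + G (x, of_rat q)"
      unfolding G1_def by (intro cSUP_least) auto
    then show ?thesis by simp
  qed
  have G1_mono: "mono G1"
    unfolding G1_def by (intro monoI cSUP_mono bdd) (auto intro!: mono)
  have G1_bot: "(G1 \<longlongrightarrow> 0) at_bot"
  proof (rule order_tendstoI)
    have "0 \<le> G1 x" for x using order_trans[OF nonneg G1_ge[of x 0]] .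
    then show "\<forall>\<^sub>F x in at_bot. e < G1 x" if "e < 0" for e
      using that by (auto intro!: always_eventually intro: less_le_trans)
    show "\<forall>\<^sub>F x in at_bot. G1 x < e" if e: "0 < e" for e
    proof -
      have "G1 0 - e / 2 < (SUP q::rat. G (0, of_rat q))" using e by (simp add: G1_def)
      \<comment> \<open>By \<open>dG1\<close> the part of \<open>G1\<close> above a fixed height is
        largest at 0 among all \<open>x \<le> 0\<close>, so one height serves all of them.\<close>
      then obtain q :: rat where "G1 0 - e / 2 < G (0, of_rat q)"
        using less_cSUP_iff[OF _ bdd] by blast
      then have q: "G1 0 - G (0, of_rat q) < e / 2" by simp
      have "\<forall>\<^sub>F x in at_bot. G (x, of_rat q) < e / 2"
        using order_tendstoD(2)[OF distribution_likeD(2)[OF G], of "e / 2"] e by auto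
      with eventually_le_at_bot[of 0] show ?thesis
      proof eventually_elim
        case (elim x)
        then show ?case using dG1[OF elim(1), of q] q by simp
      qed
    qed
  qed
  obtain m where m: "finite_borel_measure m" "\<And>x. (G1 \<longlongrightarrow> cdf m x) (at_right x)"
    using stieltjes_measure_exists[OF G1_mono G1_bot G1_le] by blast
  interpret m: finite_borel_measure m by fact
  have Gq_mono: "mono (\<lambda>x. G (x, y))" for y by (intro monoI mono) auto
  have "\<exists>n. finite_borel_measure n \<and> (\<forall>x. ((\<lambda>x. G (x, of_rat q)) \<longlongrightarrow> cdf n x) (at_right x))" for q :: rat
    using stieltjes_measure_exists[OF Gq_mono distribution_likeD(2)[OF G] M] by metis
  then obtain n where n: "\<And>q. finite_borel_measure (n q)"
    "\<And>q x. ((\<lambda>x. G (x, of_rat q)) \<longlongrightarrow> cdf (n q) x) (at_right x)" by metis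
  have sets_n [simp]: "sets (n q) = sets borel" for q
    using n(1) by (simp add: finite_borel_measure.M_is_borel)
  \<comment> \<open>\<open>R\<close> dominates \<open>n q\<close> because the difference of their
    distribution functions generates a measure \<open>k\<close> with sum
    \<open>R = n q + k\<close>.\<close>
  have le: "emeasure (n q) A \<le> emeasure R A"
    if R: "finite_borel_measure R" "\<And>x. (g \<longlongrightarrow> cdf R x) (at_right x)"
      and g: "mono (\<lambda>x. g x - G (x, of_rat q))" "(g \<longlongrightarrow> 0) at_bot" "\<And>x. g x \<le> M"
      and A: "A \<in> sets borel"
    for q R g A
  proof -
    have "((\<lambda>x. g x - G (x, of_rat q)) \<longlongrightarrow> 0) at_bot"
      using tendsto_diff[OF g(2) distribution_likeD(2)[OF G, of "of_rat q"]] by simp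
    moreover have "g x - G (x, of_rat q) \<le> M" for x
      using g(3)[of x] nonneg[of x "of_rat q"] by simp
    ultimately obtain k where k: "finite_borel_measure k"
      "\<And>x. ((\<lambda>x. g x - G (x, of_rat q)) \<longlongrightarrow> cdf k x) (at_right x)"
      using stieltjes_measure_exists[OF g(1)] by metis
    have "cdf R x = cdf (n q) x + cdf k x" for x
      using tendsto_unique[OF _ R(2) tendsto_add[OF n(2)[of q x] k(2)[of x], simplified]] by simp
    from emeasure_eq_add_of_cdf[OF R(1) n(1) k(1) this A] show ?thesis by simp
  qed
  have n_le_m: "emeasure (n q) A \<le> emeasure m A" if "A \<in> sets borel" for q A
    using dG1[of _ _ q] that by (intro le[OF m _ G1_bot G1_le] monoI) auto
  have n_le_n: "emeasure (n q) A \<le> emeasure (n r) A" if "A \<in> sets borel" "q \<le> r" for q r A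
  proof (rule le[OF n(1) n(2) monoI distribution_likeD(2)[OF G] M that(1)])
    fix x x' :: real assume "x \<le> x'"
    then have "0 \<le> rect_diff G x x' (of_rat q) (of_rat r)"
      using that by (intro distribution_likeD(1)[OF G]) (auto simp: of_rat_less_eq)
    then show "G (x, of_rat r) - G (x, of_rat q) \<le> G (x', of_rat r) - G (x', of_rat q)"
      by (simp add: rect_diff_def)
  qed
  define H where "H q = RN_deriv m (n q)" for q
  have H_meas: "H q \<in> borel_measurable m" for q unfolding H_def by simp
  have ac: "absolutely_continuous m (n q)" for q
    using n_le_m[of _ q] by (auto simp: absolutely_continuous_def null_sets_def m.M_is_borel) (metis le_zero_eq)
  have dens: "density m (H q) = n q" for q
    unfolding H_def by (rule m.density_RN_deriv[OF ac]) (simp add: m.M_is_borel)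
  have fin: "(\<integral>\<^sup>+u. H q u \<partial>m) < \<infinity>" for q
  proof -
    have "(\<integral>\<^sup>+u. H q u \<partial>m) = emeasure (density m (H q)) (space m)"
      using H_meas by (simp add: emeasure_density cong: nn_integral_cong)
    also have "\<dots> \<le> emeasure m UNIV" unfolding dens m.borel_UNIV by (rule n_le_m) simp
    also have "\<dots> < \<infinity>" by (simp add: less_top[symmetric])
    finally show ?thesis .
  qed
  have AE_mono: "AE u in m. H q u \<le> H r u" if "q \<le> r" for q r
    by (rule AE_le_of_density_le[OF m.finite_measure_axioms H_meas H_meas fin])
       (use n_le_n[OF _ that] in \<open>simp add: dens m.M_is_borel\<close>)
  have AE_1: "AE u in m. H q u \<le> 1" for q
  proof (rule AE_le_of_density_le[OF m.finite_measure_axioms H_meas])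
    show "(\<integral>\<^sup>+u. 1 \<partial>m) < \<infinity>" by (simp add: less_top[symmetric])
    show "emeasure (density m (H q)) A \<le> emeasure (density m (\<lambda>x. 1)) A" if "A \<in> sets m" for A
      using that n_le_m[of A q] by (simp add: dens density_1 m.M_is_borel)
  qed simp
  \<comment> \<open>Countably many almost sure relations hold off one null set. On that set
    \<open>h\<close> is put to 0, so that its monotonicity and bounds hold at every point.\<close>
  define good where "good u \<longleftrightarrow> (\<forall>q r. q \<le> r \<longrightarrow> H q u \<le> H r u) \<and> (\<forall>q. H q u \<le> 1)" for u
  have AE_good: "AE u in m. good u"
  proof -
    have "AE u in m. q \<le> r \<longrightarrow> H q u \<le> H r u" for q r using AE_mono[of q r] by (cases "q \<le> r") auto
    then show ?thesis unfolding good_def AE_conj_iff AE_all_countable using AE_1 by auto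
  qed
  define h where "h q u = (if good u then enn2real (H q u) else 0)" for q u
  have mb: "borel_measurable m = (borel_measurable borel :: (real \<Rightarrow> 'x::topological_space) set)"
    by (rule measurable_cong_sets) (auto simp: m.M_is_borel)
  have [measurable]: "H q \<in> borel_measurable borel" for q using H_meas[of q] by (simp add: mb)
  have [measurable]: "Measurable.pred borel good" unfolding good_def[abs_def] by measurable
  have Hfin: "H q u < top" if "good u" for q u
    using that by (auto simp: good_def intro: le_less_trans)
  have AE_h: "AE u in m. ennreal (h q u) = H q u" for q
    using AE_good by eventually_elim (auto simp: h_def Hfin)
  have int: "(\<integral>\<^sup>+u. ennreal (h q u) * indicator {..<x} u \<partial>m) = ennreal (measure (n q) {..<x})" for q x
  proof -
    interpret n: finite_borel_measure "n q" by (rule n)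
    have "(\<integral>\<^sup>+u. ennreal (h q u) * indicator {..<x} u \<partial>m) = (\<integral>\<^sup>+u. H q u * indicator {..<x} u \<partial>m)"
      by (rule nn_integral_cong_AE) (use AE_h[of q] in \<open>eventually_elim, simp\<close>)
    also have "\<dots> = emeasure (density m (H q)) {..<x}"
      using H_meas by (simp add: emeasure_density m.M_is_borel)
    also have "\<dots> = ennreal (measure (n q) {..<x})"
      unfolding dens by (rule n.emeasure_eq_measure)
    finally show ?thesis .
  qed
  note n_lt = stieltjes_measure_lessThan[OF Gq_mono n]
  show ?thesis
  proof (rule that[of m h])
    show "finite_borel_measure m" by fact
    show "h q \<in> borel_measurable borel" for q unfolding h_def by measurable
    show "0 \<le> h q u" for q u by (simp add: h_def)
    show "h q u \<le> 1" for q u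
      using enn2real_mono[of "H q u" 1] by (auto simp: h_def good_def)
    show "h q u \<le> h r u" if "q \<le> r" for q r u
      using that enn2real_mono[of "H q u" "H r u"] Hfin[of u r] by (auto simp: h_def good_def)
    show "(\<integral>\<^sup>+u. ennreal (h q u) * indicator {..<x} u \<partial>m) \<le> ennreal (G (x, of_rat q))" for q x
      unfolding int by (intro ennreal_leI n_lt)
    show "ennreal (G (s, of_rat q)) \<le> (\<integral>\<^sup>+u. ennreal (h q u) * indicator {..<x} u \<partial>m)" if "s < x" for q s x
      unfolding int using that by (intro ennreal_leI n_lt)
    \<comment> \<open>No mass escapes to infinite height: the \<open>m\<close>-mass of a ray is
      approximated by \<open>G\<close> at a single finite height. This later excludes infinite
      quantiles.\<close>
    show "\<exists>q s. s < x \<and> measure m {..<x} < G (s, of_rat q) + e" if e: "0 < e" for x e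
    proof -
      have "\<forall>\<^sub>F s in at_left x. measure m {..<x} - e / 2 < cdf m s"
        using order_tendstoD(1)[OF m.cdf_at_left, of "measure m {..<x} - e / 2"] e by auto
      then have "\<forall>\<^sub>F s in at_left x. s < x \<and> measure m {..<x} - e / 2 < cdf m s"
        by (auto simp: eventually_at_filter elim: eventually_mono)
      then obtain s where s: "s < x" "measure m {..<x} - e / 2 < cdf m s"
        using eventually_happens'[OF trivial_limit_at_left_real] by blast
      obtain t where t: "s < t" "t < x" using dense[OF s(1)] by blast
      have "cdf m s \<le> G1 t"
        by (rule tendsto_upperbound[OF m(2)])
           (use t in \<open>auto simp: eventually_at_right_field intro!: exI[of _ t] monoD[OF G1_mono]\<close>)
      then have "measure m {..<x} - e < G1 t" using s e by simp
      then obtain q :: rat where "measure m {..<x} - e < G (t, of_rat q)"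
        using less_cSUP_iff[OF _ bdd, of "measure m {..<x} - e" t] by (auto simp: G1_def)
      then show ?thesis using t by (intro exI[of _ q] exI[of _ t]) simp
    qed
  qed
qed

text \<open>In its rational argument \<open>h\<close> need not be continuous from any side, nor tend
  to 0 and 1, so it is not a distribution function. Two facts repair this: whether the quantile lies
  below \<open>y\<close> depends only on the rationals less than \<open>y\<close>
  (\<open>V_less\<close>), and the points where the quantile would be infinite form the null set
  \<open>bad\<close>.\<close>

lemma represents_exists:
  assumes G: "distribution_like G"
  obtains N where "represents N G"
proof -
  obtain m :: "real measure" and h :: "rat \<Rightarrow> real \<Rightarrow> real"
    where m: "finite_borel_measure m" and h_meas [measurable]: "\<And>q. h q \<in> borel_measurable borel"
    and h: "\<And>q u. 0 \<le> h q u" "\<And>q u. h q u \<le> 1" "\<And>q r u. q \<le> r \<Longrightarrow> h q u \<le> h r u"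
    and upper: "\<And>q x. (\<integral>\<^sup>+u. ennreal (h q u) * indicator {..<x} u \<partial>m) \<le> ennreal (G (x, of_rat q))"
    and lower: "\<And>q s x. s < x \<Longrightarrow> ennreal (G (s, of_rat q)) \<le> (\<integral>\<^sup>+u. ennreal (h q u) * indicator {..<x} u \<partial>m)"
    and total: "\<And>x e. 0 < e \<Longrightarrow> \<exists>q s. s < x \<and> measure m {..<x} < G (s, of_rat q) + e"
    using mono_densities[OF G] by blast
  note mono = distribution_like_mono[OF G] and nonneg = distribution_like_nonneg[OF G]
  interpret m: finite_borel_measure m by fact
  have sets_m [measurable_cong]: "sets m = sets borel" by (rule m.M_is_borel)
  define L where "L = uniform_measure lborel {0<..1::real}"
  interpret L: prob_space L unfolding L_def by (rule prob_space_uniform_measure) auto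
  have sets_L [measurable_cong]: "sets L = sets borel" by (simp add: L_def)
  have L_le: "emeasure L {..a} = ennreal a" if "0 \<le> a" "a \<le> 1" for a
  proof -
    have "{0<..1} \<inter> {..a} = {0<..a}" using that by auto
    then show ?thesis using that by (simp add: L_def divide_ennreal_def)
  qed
  define R where "R = m \<Otimes>\<^sub>M L"
  have sets_R [measurable_cong]: "sets R = sets (borel \<Otimes>\<^sub>M borel)"
    unfolding R_def by (intro sets_pair_measure_cong sets_m sets_L)
  have space_R: "space R = UNIV" using sets_eq_imp_space_eq[OF sets_R] by (simp add: space_pair_measure)
  interpret R: finite_measure R
    unfolding R_def by (rule finite_measure_pair_measure) unfold_locales
  \<comment> \<open>The section of \<open>E x q\<close> at \<open>u < x\<close> has uniform
    probability \<open>h q u\<close>, so this event plays the role of the quantile being at most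
    \<open>q\<close>.\<close>
  define E where "E x q = {p. fst p < x \<and> snd p \<le> h q (fst p)}" for x q
  have E_sets [measurable]: "E x q \<in> sets R" for x q
  proof -
    have "Measurable.pred (borel \<Otimes>\<^sub>M borel) (\<lambda>p. fst p < x \<and> snd p \<le> h q (fst p))" by measurable
    then show ?thesis unfolding E_def pred_def sets_R by (simp add: space_pair_measure)
  qed
  have S_sets [measurable]: "{p. fst p < x} \<in> sets R" for x :: real
  proof -
    have "Measurable.pred (borel \<Otimes>\<^sub>M borel) (\<lambda>p::real \<times> real. fst p < x)" by measurable
    then show ?thesis unfolding pred_def sets_R by (simp add: space_pair_measure)
  qed
  have E_em: "emeasure R (E x q) = (\<integral>\<^sup>+u. ennreal (h q u) * indicator {..<x} u \<partial>m)" for x q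
  proof -
    have "emeasure R (E x q) = (\<integral>\<^sup>+u. emeasure L (Pair u -` E x q) \<partial>m)"
      using E_sets[of x q] unfolding R_def by (rule L.emeasure_pair_measure_alt)
    also have "Pair u -` E x q = (if u < x then {..h q u} else {})" for u
      by (auto simp: E_def)
    then have "(\<integral>\<^sup>+u. emeasure L (Pair u -` E x q) \<partial>m) = (\<integral>\<^sup>+u. ennreal (h q u) * indicator {..<x} u \<partial>m)"
      by (intro nn_integral_cong) (auto simp: L_le h)
    finally show ?thesis .
  qed
  have E_upper: "measure R (E x q) \<le> G (x, of_rat q)" for x q
    using upper[of q x] unfolding E_em[symmetric] R.emeasure_eq_measure by (simp add: nonneg)
  have E_lower: "G (s, of_rat q) \<le> measure R (E x q)" if "s < x" for s x q
    using lower[OF that, of q] unfolding E_em[symmetric] R.emeasure_eq_measure by simp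
  have E_mono: "E x q \<subseteq> E x r" if "q \<le> r" for x q r
    using h(3)[OF that] by (auto simp: E_def intro: order_trans)
  have E_S: "E x q \<subseteq> {p. fst p < x}" for x q by (auto simp: E_def)
  have S_eq: "measure R {p. fst p < x} = measure m {..<x}" for x
  proof -
    have "emeasure R {p. fst p < x} = emeasure R ({..<x} \<times> space L)"
      by (rule arg_cong[where f = "emeasure R"]) (auto simp: L_def)
    also have "\<dots> = emeasure m {..<x}"
      unfolding R_def by (subst L.emeasure_pair_measure_Times) (auto simp: sets_m L.emeasure_space_1)
    finally show ?thesis by (simp add: measure_def)
  qed
  \<comment> \<open>The conditional quantile function; together with the first coordinate it maps the product of
    \<open>m\<close> and the uniform distribution to the required measure.\<close>
  define V where "V p = (if (\<exists>q. snd p \<le> h q (fst p)) \<and> (\<exists>q. \<not> snd p \<le> h q (fst p))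
    then Inf (of_rat ` {q. snd p \<le> h q (fst p)}) else (0::real))" for p
  define bad where "bad = {p. (\<forall>q. snd p \<le> h q (fst p)) \<or> (\<forall>q. \<not> snd p \<le> h q (fst p))}"
  have V_less: "V p < y \<longleftrightarrow> (\<exists>q. of_rat q < y \<and> snd p \<le> h q (fst p))" if "p \<notin> bad" for p y
  proof -
    let ?S = "{q. snd p \<le> h q (fst p)}"
    from that obtain q0 where q0: "\<not> snd p \<le> h q0 (fst p)" and ne: "?S \<noteq> {}" by (auto simp: bad_def)
    have "q0 \<le> q" if "q \<in> ?S" for q
      using that q0 h(3)[of q q0 "fst p"] by (cases "q \<le> q0") auto
    then have "bdd_below (of_rat ` ?S :: real set)"
      by (intro bdd_belowI[of _ "of_rat q0"]) (auto simp: of_rat_less_eq)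
    then have "V p < y \<longleftrightarrow> (\<exists>r\<in>of_rat ` ?S. r < y)"
      using that ne by (subst cInf_less_iff[symmetric]) (auto simp: V_def bad_def)
    then show ?thesis by auto
  qed
  have [measurable]: "Measurable.pred (borel \<Otimes>\<^sub>M borel) (\<lambda>p. p \<in> bad)"
    unfolding bad_def mem_Collect_eq by measurable
  have bad_sets [measurable]: "bad \<in> sets R"
    using \<open>Measurable.pred (borel \<Otimes>\<^sub>M borel) (\<lambda>p. p \<in> bad)\<close>
    unfolding pred_def sets_R by (simp add: space_pair_measure)
  have V_meas [measurable]: "V \<in> borel_measurable (borel \<Otimes>\<^sub>M borel)"
  proof (rule borel_measurableI_less)
    fix y
    have "V p < y \<longleftrightarrow> (if p \<in> bad then 0 < y else \<exists>q. of_rat q < y \<and> snd p \<le> h q (fst p))" for p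
      using V_less[of p y] by (auto simp: V_def bad_def)
    moreover have "Measurable.pred (borel \<Otimes>\<^sub>M borel)
        (\<lambda>p. if p \<in> bad then 0 < y else \<exists>q. of_rat q < y \<and> snd p \<le> h q (fst p))"
      by measurable
    ultimately show "{p \<in> space (borel \<Otimes>\<^sub>M borel). V p < y} \<in> sets (borel \<Otimes>\<^sub>M borel)"
      unfolding pred_def by simp
  qed
  have bad_null: "bad \<in> null_sets R"
  proof -
    have small: "measure R (bad \<inter> {p. fst p < x}) \<le> 2 * e" if e: "0 < e" for x e
    proof -
      obtain q s where q: "s < x" "measure m {..<x} < G (s, of_rat q) + e" using total[OF e] by blast
      have "\<forall>\<^sub>F y in at_bot. G (x, y) < e"
        using order_tendstoD(2)[OF distribution_likeD(3)[OF G], of e] e by auto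
      then obtain y where y: "\<And>z. z \<le> y \<Longrightarrow> G (x, z) < e" unfolding eventually_at_bot_linorder by blast
      obtain r :: rat where "y - 1 < of_rat r" "of_rat r < y" using of_rat_dense[of "y - 1" y] by auto
      then have r: "G (x, of_rat r) < e" using y by simp
      \<comment> \<open>A bad point lies under every \<open>h q\<close>, hence in
        \<open>E x r\<close> where \<open>G (x, of_rat r)\<close> is small, or above every
        \<open>h q\<close>, hence outside \<open>E x q\<close>, which nearly exhausts the mass left
        of \<open>x\<close>. Each alternative costs at most \<open>e\<close>.\<close>
      have "bad \<inter> {p. fst p < x} \<subseteq> E x r \<union> ({p. fst p < x} - E x q)"
        by (auto simp: bad_def E_def)
      then have "measure R (bad \<inter> {p. fst p < x}) \<le> measure R (E x r \<union> ({p. fst p < x} - E x q))"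
        by (intro R.finite_measure_mono) measurable
      also have "\<dots> \<le> measure R (E x r) + measure R ({p. fst p < x} - E x q)"
        by (intro measure_Un_le) measurable
      also have "measure R ({p. fst p < x} - E x q) = measure m {..<x} - measure R (E x q)"
        unfolding S_eq[symmetric] by (intro R.finite_measure_Diff E_S) measurable
      finally show ?thesis
        using E_upper[of x r] E_lower[OF q(1), of q] q(2) r by linarith
    qed
    have "measure R (bad \<inter> {p. fst p < x}) = 0" for x
    proof (rule antisym[OF field_le_epsilon])
      show "measure R (bad \<inter> {p. fst p < x}) \<le> 0 + e" if "0 < e" for e
        using small[of "e / 2" x] that by simp
    qed simp
    then have "bad \<inter> {p. fst p < real n} \<in> null_sets R" for n :: nat
      by (auto simp: null_sets_def R.emeasure_eq_measure)
    then have "(\<Union>n::nat. bad \<inter> {p. fst p < real n}) \<in> null_sets R" by (rule null_sets_UN)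
    also have "(\<Union>n::nat. bad \<inter> {p. fst p < real n}) = bad" using reals_Archimedean2 by auto
    finally show ?thesis .
  qed
  define N where "N = distr R borel (\<lambda>p. (fst p, V p))"
  have meas: "(\<lambda>p. (fst p, V p)) \<in> measurable R borel"
    unfolding borel_prod[symmetric] by measurable
  have fin_N: "finite_measure N" unfolding N_def by (rule R.finite_measure_distr[OF meas])
  have quad_sets: "quadrant x y \<in> sets borel" for x y
    unfolding quadrant_def by (intro borel_Times) auto
  have N_eq: "measure N (quadrant x y) = measure R (\<Union>q\<in>{q. of_rat q < y}. E x q)" for x y
  proof -
    have "measure N (quadrant x y) = measure R ((\<lambda>p. (fst p, V p)) -` quadrant x y \<inter> space R)"
      unfolding N_def by (rule measure_distr[OF meas quad_sets])
    also have "\<dots> = measure R (\<Union>q\<in>{q. of_rat q < y}. E x q)"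
    proof (rule measure_eq_AE)
      show "AE p in R. (p \<in> (\<lambda>p. (fst p, V p)) -` quadrant x y \<inter> space R) =
          (p \<in> (\<Union>q\<in>{q. of_rat q < y}. E x q))"
        using AE_not_in[OF bad_null]
        by eventually_elim (auto simp: V_less quadrant_def space_R E_def)
      show "(\<lambda>p. (fst p, V p)) -` quadrant x y \<inter> space R \<in> sets R"
        by (rule measurable_sets[OF meas quad_sets])
    qed measurable
    finally show ?thesis .
  qed
  have "measure N (quadrant x y) \<le> G (x, y)" for x y
  proof -
    obtain q0 :: rat where "y - 1 < of_rat q0" "of_rat q0 < y" using of_rat_dense[of "y - 1" y] by auto
    then have "{q::rat. of_rat q < y} \<noteq> {}" by auto
    then have c: "range (from_nat_into {q::rat. of_rat q < y}) = {q. of_rat q < y}"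
      by (rule range_from_nat_into) (rule countableI_type)
    define c where "c = from_nat_into {q::rat. of_rat q < y}"
    note c = c[folded c_def]
    \<comment> \<open>Running maxima turn an enumeration of the rationals below \<open>y\<close>
      into an increasing sequence of events, as continuity from below demands.\<close>
    define r where "r n = Max (c ` {..n})" for n :: nat
    have r_less: "of_rat (r n) < y" for n
    proof -
      have "r n \<in> c ` {..n}" unfolding r_def by (rule Max_in) auto
      then have "r n \<in> range c" by blast
      then show ?thesis unfolding c by simp
    qed
    have "incseq (\<lambda>n. E x (r n))"
      unfolding incseq_def r_def by (auto intro!: E_mono Max_mono dest: subsetD)
    then have "(\<lambda>n. measure R (E x (r n))) \<longlonglongrightarrow> measure R (\<Union>n. E x (r n))"
      by (intro R.finite_Lim_measure_incseq) auto
    also have "(\<Union>n. E x (r n)) = (\<Union>q\<in>{q. of_rat q < y}. E x q)"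
    proof (rule antisym)
      show "(\<Union>n. E x (r n)) \<subseteq> (\<Union>q\<in>{q. of_rat q < y}. E x q)" using r_less by auto
      have "E x (c n) \<subseteq> E x (r n)" for n unfolding r_def by (intro E_mono Max_ge) auto
      then show "(\<Union>q\<in>{q. of_rat q < y}. E x q) \<subseteq> (\<Union>n. E x (r n))"
        unfolding c[symmetric] by blast
    qed
    finally have "(\<lambda>n. measure R (E x (r n))) \<longlonglongrightarrow> measure N (quadrant x y)" by (simp add: N_eq)
    moreover have "measure R (E x (r n)) \<le> G (x, y)" for n
      using E_upper[of x "r n"] mono[of x x "of_rat (r n)" y] r_less[of n] by simp
    ultimately show ?thesis by (intro LIMSEQ_le_const2) auto
  qed
  moreover have "G (s, t) \<le> measure N (quadrant x y)" if st: "s < x" "t < y" for s t x y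
  proof -
    obtain q :: rat where q: "t < of_rat q" "of_rat q < y" using of_rat_dense[OF st(2)] by auto
    have "G (s, t) \<le> G (s, of_rat q)" using q by (intro mono) auto
    also have "\<dots> \<le> measure R (E x q)" by (rule E_lower[OF st(1)])
    also have "\<dots> \<le> measure N (quadrant x y)"
      unfolding N_eq by (rule R.finite_measure_mono) (use q in auto)
    finally show ?thesis .
  qed
  ultimately show ?thesis using that[of N] fin_N by (auto simp: represents_def N_def)
qed

subsection \<open>Dominated convergence along countably generated filters\<close>

text \<open>The sets \<open>A n\<close> form a countable base, not assumed decreasing. Dominated
  convergence is a theorem about sequences; it transfers to such filters, and they are closed under
  the products that describe four-parameter limits.\<close>

definition countably_generated :: "'a filter \<Rightarrow> bool" where
  "countably_generated F \<longleftrightarrow> (\<exists>A :: nat \<Rightarrow> 'a set. \<forall>P. eventually P F \<longleftrightarrow> (\<exists>n. \<forall>x\<in>A n. P x))"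

lemma countably_generated_prod:
  assumes "countably_generated F" "countably_generated G"
  shows "countably_generated (F \<times>\<^sub>F G)"
proof -
  obtain A :: "nat \<Rightarrow> 'a set" where A: "\<And>P. eventually P F \<longleftrightarrow> (\<exists>n. \<forall>x\<in>A n. P x)"
    using assms(1) by (auto simp: countably_generated_def)
  obtain B :: "nat \<Rightarrow> 'b set" where B: "\<And>P. eventually P G \<longleftrightarrow> (\<exists>n. \<forall>x\<in>B n. P x)"
    using assms(2) by (auto simp: countably_generated_def)
  have "eventually P (F \<times>\<^sub>F G) \<longleftrightarrow> (\<exists>n. \<forall>x \<in> A (fst (prod_decode n)) \<times> B (snd (prod_decode n)). P x)" for P
  proof
    assume "eventually P (F \<times>\<^sub>F G)"
    then obtain Pf Pg where P: "eventually Pf F" "eventually Pg G" "\<And>x y. Pf x \<Longrightarrow> Pg y \<Longrightarrow> P (x, y)"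
      unfolding eventually_prod_filter by blast
    from P(1) obtain n where "\<forall>x\<in>A n. Pf x" unfolding A by blast
    moreover from P(2) obtain m where "\<forall>x\<in>B m. Pg x" unfolding B by blast
    ultimately have "\<forall>x\<in>A n \<times> B m. P x" by (auto intro: P(3))
    then show "\<exists>n. \<forall>x \<in> A (fst (prod_decode n)) \<times> B (snd (prod_decode n)). P x"
      by (intro exI[of _ "prod_encode (n, m)"]) simp
  next
    assume "\<exists>n. \<forall>x \<in> A (fst (prod_decode n)) \<times> B (snd (prod_decode n)). P x"
    then obtain n where n: "\<And>x. x \<in> A (fst (prod_decode n)) \<times> B (snd (prod_decode n)) \<Longrightarrow> P x" by blast
    show "eventually P (F \<times>\<^sub>F G)"
      unfolding eventually_prod_filter
    proof (intro exI conjI allI impI)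
      show "eventually (\<lambda>x. x \<in> A (fst (prod_decode n))) F" unfolding A by blast
      show "eventually (\<lambda>x. x \<in> B (snd (prod_decode n))) G" unfolding B by blast
    qed (auto intro: n)
  qed
  then show ?thesis
    unfolding countably_generated_def
    by (intro exI[of _ "\<lambda>n. A (fst (prod_decode n)) \<times> B (snd (prod_decode n))"]) blast
qed

lemma countably_generated_real:
  "countably_generated (at_top :: real filter)" "countably_generated (at_bot :: real filter)"
  "countably_generated (at_right x)" "countably_generated (at_left x)" for x :: real
proof -
  show "countably_generated (at_top :: real filter)"
    unfolding countably_generated_def
  proof (intro exI[of _ "\<lambda>n. {real n..}"] allI)
    show "eventually P at_top \<longleftrightarrow> (\<exists>n. \<forall>x\<in>{real n..}. P x)" for P
      unfolding eventually_at_top_linorder by (meson atLeast_iff order_trans real_arch_simple)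
  qed
  show "countably_generated (at_bot :: real filter)"
    unfolding countably_generated_def
  proof (intro exI[of _ "\<lambda>n. {..- real n}"] allI)
    fix P :: "real \<Rightarrow> bool"
    have "\<exists>n. - real n \<le> x" for x by (meson minus_le_iff real_arch_simple)
    then show "eventually P at_bot \<longleftrightarrow> (\<exists>n. \<forall>x\<in>{..- real n}. P x)"
      unfolding eventually_at_bot_linorder by (meson atMost_iff order_trans)
  qed
  show "countably_generated (at_right x)"
    unfolding countably_generated_def
  proof (intro exI[of _ "\<lambda>n. {x<..<x + 1 / real (Suc n)}"] allI)
    fix P :: "real \<Rightarrow> bool"
    have "\<exists>n. x + 1 / real (Suc n) < b" if "x < b" for b
      using nat_approx_posE[of "b - x"] that by (metis add.commute diff_gt_0_iff_gt less_diff_eq)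
    moreover have "x < x + 1 / real (Suc n)" for n by simp
    ultimately show "eventually P (at_right x) \<longleftrightarrow> (\<exists>n. \<forall>y\<in>{x<..<x + 1 / real (Suc n)}. P y)"
      unfolding eventually_at_right_field by (meson greaterThanLessThan_iff order_less_trans)
  qed
  show "countably_generated (at_left x)"
    unfolding countably_generated_def
  proof (intro exI[of _ "\<lambda>n. {x - 1 / real (Suc n)<..<x}"] allI)
    fix P :: "real \<Rightarrow> bool"
    have "\<exists>n. b < x - 1 / real (Suc n)" if "b < x" for b
      using nat_approx_posE[of "x - b"] that by (metis diff_gt_0_iff_gt less_diff_eq add.commute)
    moreover have "x - 1 / real (Suc n) < x" for n by simp
    ultimately show "eventually P (at_left x) \<longleftrightarrow> (\<exists>n. \<forall>y\<in>{x - 1 / real (Suc n)<..<x}. P y)"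
      unfolding eventually_at_left_field by (meson greaterThanLessThan_iff order_less_trans)
  qed
qed

text \<open>If convergence failed, bad points could be chosen in the intersections of the first base
  sets; they form a sequence tending to \<open>F\<close> that contradicts
  \<open>seq\<close>.\<close>

lemma tendsto_countably_generated:
  assumes "countably_generated F"
    and seq: "\<And>X. filterlim X F sequentially \<Longrightarrow> (\<lambda>n. g (X n)) \<longlonglongrightarrow> l"
  shows "(g \<longlongrightarrow> l) F"
proof (rule topological_tendstoI, rule ccontr)
  fix S assume S: "open S" "l \<in> S" and neg: "\<not> (\<forall>\<^sub>F x in F. g x \<in> S)"
  obtain A :: "nat \<Rightarrow> 'a set" where A: "\<And>P. eventually P F \<longleftrightarrow> (\<exists>n. \<forall>x\<in>A n. P x)"
    using assms(1) by (auto simp: countably_generated_def)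
  have "\<exists>x. (\<forall>k\<le>n. x \<in> A k) \<and> g x \<notin> S" for n
  proof (rule ccontr)
    assume no: "\<nexists>x. (\<forall>k\<le>n. x \<in> A k) \<and> g x \<notin> S"
    have "\<forall>\<^sub>F x in F. \<forall>k\<in>{..n}. x \<in> A k"
      by (rule eventually_ball_finite) (auto simp: A)
    then have "\<forall>\<^sub>F x in F. g x \<in> S" by (rule eventually_mono) (use no in auto)
    with neg show False ..
  qed
  then obtain X where X: "\<And>n k. k \<le> n \<Longrightarrow> X n \<in> A k" "\<And>n. g (X n) \<notin> S" by metis
  have "filterlim X F sequentially"
    unfolding filterlim_iff
  proof (intro allI impI)
    fix P assume "eventually P F"
    then obtain n where "\<forall>x\<in>A n. P x" unfolding A by blast
    then show "\<forall>\<^sub>F k in sequentially. P (X k)"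
      using X(1) by (auto simp: eventually_sequentially)
  qed
  from topological_tendstoD[OF seq[OF this] S] X(2) show False by simp
qed

lemma integral_dominated_convergence_filter:
  fixes f :: "'i \<Rightarrow> 'a \<Rightarrow> 'b::{banach, second_countable_topology}"
  assumes F: "countably_generated F" and M: "finite_measure M"
    and ev: "\<forall>\<^sub>F i in F. f i \<in> borel_measurable M \<and> (\<forall>x\<in>space M. norm (f i x) \<le> B)"
    and g: "g \<in> borel_measurable M" and lim: "\<And>x. x \<in> space M \<Longrightarrow> ((\<lambda>i. f i x) \<longlongrightarrow> g x) F"
  shows "((\<lambda>i. integral\<^sup>L M (f i)) \<longlongrightarrow> integral\<^sup>L M g) F"
proof (rule tendsto_countably_generated[OF F])
  fix X assume X: "filterlim X F sequentially"
  interpret finite_measure M by fact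
  from filterlim_iff[THEN iffD1, OF X, rule_format, OF ev]
  obtain n0 where n0: "\<And>n. n \<ge> n0 \<Longrightarrow> f (X n) \<in> borel_measurable M \<and> (\<forall>x\<in>space M. norm (f (X n) x) \<le> B)"
    by (auto simp: eventually_sequentially)
  have "(\<lambda>n. integral\<^sup>L M (f (X (n + n0)))) \<longlonglongrightarrow> integral\<^sup>L M g"
  proof (rule integral_dominated_convergence[where w = "\<lambda>_. B"])
    show "AE x in M. (\<lambda>n. f (X (n + n0)) x) \<longlonglongrightarrow> g x"
      by (intro AE_I2 LIMSEQ_ignore_initial_segment filterlim_compose[OF lim X])
  qed (use n0 g in auto)
  then show "(\<lambda>n. integral\<^sup>L M (f (X n))) \<longlonglongrightarrow> integral\<^sup>L M g" by (rule LIMSEQ_offset)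
qed

subsection \<open>One-sided limits and marginals\<close>

text \<open>\<open>A\<close> is the limit of the rays \<open>{..<s}\<close> as \<open>s\<close> tends to a point from the side given by \<open>F\<close>;
  \<open>w\<close> moves a point to its right within that side.\<close>

definition ray_limit :: "real filter \<Rightarrow> real set \<Rightarrow> bool" where
  "ray_limit F A \<longleftrightarrow> countably_generated F \<and> F \<noteq> bot \<and> A \<in> sets borel \<and>
    (\<forall>u. \<forall>\<^sub>F s in F. u < s \<longleftrightarrow> u \<in> A) \<and> (\<exists>w. filterlim w F F \<and> (\<forall>\<^sub>F s in F. s < w s))"

lemma ray_limit_at_left: "ray_limit (at_left x) {..<x}"
proof -
  have "filterlim (\<lambda>s. (s + x) / 2) (at_left x) (at_left x)"
    unfolding filterlim_at
  proof
    show "((\<lambda>s. (s + x) / 2) \<longlongrightarrow> x) (at_left x)" by (auto intro!: tendsto_eq_intros)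
  qed (auto simp: eventually_at_filter)
  moreover have "\<forall>\<^sub>F s in at_left x. s < (s + x) / 2" by (auto simp: eventually_at_filter)
  moreover have "\<forall>\<^sub>F s in at_left x. u < s \<longleftrightarrow> u \<in> {..<x}" for u
    
  proof (cases "u < x")
    case True
    then show ?thesis by (auto simp: eventually_at_left_field)
  qed (auto simp: eventually_at_filter)
  ultimately show ?thesis
    unfolding ray_limit_def using countably_generated_real trivial_limit_at_left_real by auto
qed

lemma ray_limit_at_right: "ray_limit (at_right x) {..x}"
proof -
  have "filterlim (\<lambda>s. 2 * s - x) (at_right x) (at_right x)"
    unfolding filterlim_at
  proof
    show "((\<lambda>s. 2 * s - x) \<longlongrightarrow> x) (at_right x)" by (auto intro!: tendsto_eq_intros)
  qed (auto simp: eventually_at_filter)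
  moreover have "\<forall>\<^sub>F s in at_right x. s < 2 * s - x" by (auto simp: eventually_at_filter)
  moreover have "\<forall>\<^sub>F s in at_right x. u < s \<longleftrightarrow> u \<in> {..x}" for u
  proof (cases "u \<le> x")
    case False
    then show ?thesis by (auto simp: eventually_at_right_field intro!: exI[of _ u])
  qed (auto simp: eventually_at_filter)
  ultimately show ?thesis
    unfolding ray_limit_def using countably_generated_real trivial_limit_at_right_real by auto
qed

lemma ray_limit_at_top: "ray_limit at_top UNIV"
proof -
  have "filterlim (\<lambda>s::real. 1 + s) at_top at_top"
    by (rule filterlim_tendsto_add_at_top[OF tendsto_const filterlim_ident])
  then show ?thesis
    unfolding ray_limit_def using countably_generated_real
    by (auto intro!: exI[of _ "\<lambda>s. 1 + s"] eventually_gt_at_top)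
qed

lemma representsD:
  assumes "represents N G"
  shows "finite_measure N" "sets N = sets borel" "space N = UNIV"
    "measure N (quadrant x y) \<le> G (x, y)"
    "s < x \<Longrightarrow> t < y \<Longrightarrow> G (s, t) \<le> measure N (quadrant x y)"
  using assms sets_eq_imp_space_eq[of N borel] by (auto simp: represents_def)

lemma quadrant_sets [measurable, simp]: "quadrant x y \<in> sets borel"
  unfolding quadrant_def by (intro borel_Times) auto

lemma measure_quadrant_tendsto:
  assumes N: "finite_measure N" "sets N = sets borel" and A: "ray_limit F A" and B: "ray_limit F' B"
  shows "((\<lambda>(s, t). measure N (quadrant s t)) \<longlongrightarrow> measure N (A \<times> B)) (F \<times>\<^sub>F F')"
proof -
  note [measurable_cong] = N(2)
  have AB: "A \<times> B \<in> sets borel" using A B by (intro borel_Times) (auto simp: ray_limit_def)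
  have "((\<lambda>p. integral\<^sup>L N (indicator (quadrant (fst p) (snd p)) :: _ \<Rightarrow> real))
      \<longlongrightarrow> integral\<^sup>L N (indicator (A \<times> B))) (F \<times>\<^sub>F F')"
  proof (rule integral_dominated_convergence_filter[OF _ N(1), where B = 1])
    show "countably_generated (F \<times>\<^sub>F F')"
      using A B by (auto simp: ray_limit_def intro: countably_generated_prod)
    show "((\<lambda>i. indicator (quadrant (fst i) (snd i)) w) \<longlongrightarrow> (indicator (A \<times> B) w :: real)) (F \<times>\<^sub>F F')" for w
    proof (rule tendsto_eventually)
      have "\<forall>\<^sub>F s in F. fst w < s \<longleftrightarrow> fst w \<in> A" "\<forall>\<^sub>F t in F'. snd w < t \<longleftrightarrow> snd w \<in> B"
        using A B by (auto simp: ray_limit_def)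
      then have "\<forall>\<^sub>F i in F \<times>\<^sub>F F'. (fst w < fst i \<longleftrightarrow> fst w \<in> A) \<and> (snd w < snd i \<longleftrightarrow> snd w \<in> B)"
        unfolding eventually_prod_filter by (intro exI conjI) auto
      then show "\<forall>\<^sub>F i in F \<times>\<^sub>F F'. indicator (quadrant (fst i) (snd i)) w = (indicator (A \<times> B) w :: real)"
        by (rule eventually_mono) (cases w, auto simp: quadrant_def indicator_def)
    qed
  qed (use AB in \<open>auto intro!: always_eventually simp: indicator_def\<close>)
  then show ?thesis using AB by (simp add: N sets_eq_imp_space_eq[OF N(2)] case_prod_unfold)
qed

text \<open>\<open>G\<close> lies between the quadrant measure at a point and the one at a point
  moved strictly up and to the right. Both have the same limit, whatever values \<open>G\<close>
  takes at its jumps.\<close>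

lemma represents_tendsto:
  assumes N: "represents N G" and A: "ray_limit F A" and B: "ray_limit F' B"
  shows "(G \<longlongrightarrow> measure N (A \<times> B)) (F \<times>\<^sub>F F')"
proof -
  note N' = representsD[OF N]
  note lim = measure_quadrant_tendsto[OF N'(1,2) A B]
  obtain w w' where w: "filterlim w F F" "\<forall>\<^sub>F s in F. s < w s" "filterlim w' F' F'" "\<forall>\<^sub>F s in F'. s < w' s"
    using A B by (auto simp: ray_limit_def)
  have "filterlim (\<lambda>p. (w (fst p), w' (snd p))) (F \<times>\<^sub>F F') (F \<times>\<^sub>F F')"
    by (intro filterlim_Pair filterlim_compose[OF w(1)] filterlim_compose[OF w(3)] filterlim_fst filterlim_snd)
  from filterlim_compose[OF lim this]
  have upper: "((\<lambda>p. measure N (quadrant (w (fst p)) (w' (snd p)))) \<longlongrightarrow> measure N (A \<times> B)) (F \<times>\<^sub>F F')"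
    by simp
  have "\<forall>\<^sub>F p in F \<times>\<^sub>F F'. fst p < w (fst p) \<and> snd p < w' (snd p)"
    unfolding eventually_prod_filter using w(2,4) by (intro exI conjI) auto
  then have "\<forall>\<^sub>F p in F \<times>\<^sub>F F'. G p \<le> measure N (quadrant (w (fst p)) (w' (snd p)))"
    by (rule eventually_mono) (metis N'(5) prod.collapse)
  moreover have "\<forall>\<^sub>F p in F \<times>\<^sub>F F'. (case p of (s, t) \<Rightarrow> measure N (quadrant s t)) \<le> G p"
    by (auto intro!: always_eventually N'(4))
  ultimately show ?thesis by (intro tendsto_sandwich[OF _ _ lim upper])
qed

lemma projections_measurable:
  assumes "sets N = sets (borel :: (real \<times> real) measure)"
  shows "fst \<in> borel_measurable N" "snd \<in> borel_measurable N"
  unfolding measurable_cong_sets[OF assms refl] borel_prod[symmetric] by simp_all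

section \<open>The signed measure and its marginals\<close>

locale represented_function =
  fixes f G H :: "real \<times> real \<Rightarrow> real" and N1 N2 :: "(real \<times> real) measure"
  assumes G: "distribution_like G" and H: "distribution_like H"
    and N1: "represents N1 G" and N2: "represents N2 H"
    and f_eq: "\<And>p. f p = G p - H p" and f_lim: "(f \<longlongrightarrow> 0) at_infinity"
begin

sublocale N1: finite_measure N1 by (rule representsD[OF N1])
sublocale N2: finite_measure N2 by (rule representsD[OF N2])

lemma sets_N [measurable_cong, simp]: "sets N1 = sets borel" "sets N2 = sets borel"
  using representsD(2) N1 N2 by auto

lemma space_N [simp]: "space N1 = UNIV" "space N2 = UNIV"
  using representsD(3) N1 N2 by auto

lemma f_tendsto:
  assumes "ray_limit F A" "ray_limit F' B"
  shows "(f \<longlongrightarrow> measure N1 (A \<times> B) - measure N2 (A \<times> B)) (F \<times>\<^sub>F F')"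
  unfolding f_eq[abs_def] by (intro tendsto_diff represents_tendsto assms N1 N2)

text \<open>As one coordinate tends to plus infinity, f tends both to 0 and to the difference of the
  two half-plane masses.\<close>

lemma ray_marginals_eq:
  assumes A: "ray_limit F A"
  shows "measure N1 (UNIV \<times> A) = measure N2 (UNIV \<times> A)" "measure N1 (A \<times> UNIV) = measure N2 (A \<times> UNIV)"
proof -
  have F: "F \<noteq> bot" using A by (simp add: ray_limit_def)
  have "filterlim fst at_infinity ((at_top :: real filter) \<times>\<^sub>F F)"
    by (intro filterlim_compose[OF filterlim_at_top_imp_at_infinity filterlim_fst] filterlim_ident)
  from filterlim_compose[OF f_lim filterlim_Pair_at_infinity(1)[OF this, of snd]]
  have "(f \<longlongrightarrow> 0) (at_top \<times>\<^sub>F F)" by simp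
  from tendsto_unique[OF _ f_tendsto[OF ray_limit_at_top A] this] F
  show "measure N1 (UNIV \<times> A) = measure N2 (UNIV \<times> A)" by (simp add: prod_filter_eq_bot)
  have "filterlim snd at_infinity (F \<times>\<^sub>F (at_top :: real filter))"
    by (intro filterlim_compose[OF filterlim_at_top_imp_at_infinity filterlim_snd] filterlim_ident)
  from filterlim_compose[OF f_lim filterlim_Pair_at_infinity(2)[OF this, of fst]]
  have "(f \<longlongrightarrow> 0) (F \<times>\<^sub>F at_top)" by simp
  from tendsto_unique[OF _ f_tendsto[OF A ray_limit_at_top] this] F
  show "measure N1 (A \<times> UNIV) = measure N2 (A \<times> UNIV)" by (simp add: prod_filter_eq_bot)
qed

lemma finite_borel_measure_distr:
  assumes "finite_measure N" and [measurable_cong]: "sets N = sets borel" and [measurable]: "g \<in> borel_measurable borel"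
  shows "finite_borel_measure (distr N borel (g :: real \<times> real \<Rightarrow> real))"
proof -
  interpret finite_measure N by fact
  show ?thesis
    by (intro finite_borel_measure.intro finite_borel_measure_axioms.intro finite_measure_distr) auto
qed

lemma marginals_eq:
  "distr N1 borel fst = distr N2 borel fst" "distr N1 borel snd = distr N2 borel snd"
proof -
  have vim: "fst -` {..x} = {..x} \<times> (UNIV :: real set)" "snd -` {..x} = (UNIV :: real set) \<times> {..x}" for x :: real
    by auto
  have "cdf (distr N1 borel fst) = cdf (distr N2 borel fst)"
    using ray_marginals_eq(2)[OF ray_limit_at_right] by (auto simp: cdf_def measure_distr projections_measurable vim)
  then show "distr N1 borel fst = distr N2 borel fst"
    by (intro cdf_unique' finite_borel_measure_distr) (auto simp: N1.finite_measure_axioms N2.finite_measure_axioms projections_measurable)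
  have "cdf (distr N1 borel snd) = cdf (distr N2 borel snd)"
    using ray_marginals_eq(1)[OF ray_limit_at_right] by (auto simp: cdf_def measure_distr projections_measurable vim)
  then show "distr N1 borel snd = distr N2 borel snd"
    by (intro cdf_unique' finite_borel_measure_distr) (auto simp: N1.finite_measure_axioms N2.finite_measure_axioms projections_measurable)
qed

text \<open>The integral against the signed measure \<open>\<mu>\<close>, kept as a difference of
  integrals against its two positive parts.\<close>

definition J :: "(real \<times> real \<Rightarrow> complex) \<Rightarrow> complex" where
  "J g = integral\<^sup>L N1 g - integral\<^sup>L N2 g"

definition admissible :: "(real \<times> real \<Rightarrow> complex) \<Rightarrow> bool" where
  "admissible g \<longleftrightarrow> g \<in> borel_measurable borel \<and> (\<exists>B. \<forall>p. norm (g p) \<le> B)"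

lemma admissible_integrable:
  assumes "admissible g"
  shows "integrable N1 g" "integrable N2 g"
proof -
  obtain B where [measurable]: "g \<in> borel_measurable borel" and "\<And>p. norm (g p) \<le> B"
    using assms by (auto simp: admissible_def)
  then show "integrable N1 g" "integrable N2 g"
    by (auto intro!: N1.integrable_const_bound[of _ B] N2.integrable_const_bound[of _ B])
qed

lemma J_add: "admissible g \<Longrightarrow> admissible h \<Longrightarrow> J (\<lambda>p. g p + h p) = J g + J h"
  by (simp add: J_def admissible_integrable)

lemma J_diff: "admissible g \<Longrightarrow> admissible h \<Longrightarrow> J (\<lambda>p. g p - h p) = J g - J h"
  by (simp add: J_def admissible_integrable)

lemma J_cmult: "J (\<lambda>p. c * g p) = c * J g"
  by (simp add: J_def algebra_simps)

lemma J_marginal: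
  assumes [measurable]: "g \<in> borel_measurable borel"
  shows "J (\<lambda>p. g (fst p)) = 0" "J (\<lambda>p. g (snd p)) = 0"
proof -
  have *: "integral\<^sup>L N (\<lambda>p. g (pr p)) = integral\<^sup>L (distr N borel pr) g"
    if "pr \<in> borel_measurable N" for N and pr :: "real \<times> real \<Rightarrow> real"
    by (rule integral_distr[symmetric]) (use that in simp_all)
  show "J (\<lambda>p. g (fst p)) = 0" "J (\<lambda>p. g (snd p)) = 0"
    unfolding J_def by (simp_all add: * projections_measurable marginals_eq)
qed

lemma J_tendsto:
  assumes F: "countably_generated F" and ev: "\<forall>\<^sub>F i in F. h i \<in> borel_measurable borel \<and> (\<forall>p. norm (h i p) \<le> B)"
    and g: "g \<in> borel_measurable borel" and lim: "\<And>p. ((\<lambda>i. h i p) \<longlongrightarrow> g p) F"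
  shows "((\<lambda>i. J (h i)) \<longlongrightarrow> J g) F"
proof -
  have m: "borel_measurable N1 = borel_measurable borel" "borel_measurable N2 = borel_measurable borel"
    by (auto intro!: measurable_cong_sets)
  show ?thesis
    unfolding J_def using ev g
    by (intro tendsto_diff integral_dominated_convergence_filter[OF F, where B = B] lim
        N1.finite_measure_axioms N2.finite_measure_axioms) (auto simp: m)
qed

text \<open>The quadrant formula can fail only on vertical and horizontal lines that carry mass, and
  a finite marginal has at most countably many atoms.\<close>

lemma negligible_discontinuities:
  "negligible {(s, t). f (s, t) \<noteq> measure N1 (quadrant s t) - measure N2 (quadrant s t)}"
proof -
  define D where "D N (pr :: real \<times> real \<Rightarrow> real) = {x. measure (distr N borel pr) {x} \<noteq> 0}" for N pr
  have cD: "countable (D N pr)" if "finite_measure N" "sets N = sets borel" "pr \<in> borel_measurable borel" for N pr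
  proof -
    interpret finite_borel_measure "distr N borel pr" using that by (rule finite_borel_measure_distr)
    show ?thesis unfolding D_def by (rule countable_support)
  qed
  have atom: "measure N (fst -` {x}) = 0" if "x \<notin> D N fst" "sets N = sets borel" for N x
    using that sets_eq_imp_space_eq[OF that(2)]
    by (auto simp: D_def measure_distr projections_measurable)
  have atom': "measure N (snd -` {x}) = 0" if "x \<notin> D N snd" "sets N = sets borel" for N x
    using that sets_eq_imp_space_eq[OF that(2)]
    by (auto simp: D_def measure_distr projections_measurable)
  have eq: "K (s, t) = measure N (quadrant s t)"
    if N: "represents N K" and K: "distribution_like K" and s: "s \<notin> D N fst" and t: "t \<notin> D N snd" for N K s t
  proof (rule antisym)
    note N' = representsD[OF N]
    interpret finite_measure N by (rule N')
    have sing: "fst -` {s} \<in> sets N" "snd -` {t} \<in> sets N"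
      using measurable_sets[OF projections_measurable(1)[OF N'(2)], of "{s}"]
        measurable_sets[OF projections_measurable(2)[OF N'(2)], of "{t}"] by (auto simp: N'(3))
    \<comment> \<open>Approach from the upper right bounds \<open>K (s, t)\<close> by the closed
      quadrant, which exceeds the open one by parts of two lines of mass 0.\<close>
    have "K (s, t) \<le> measure N ({..s} \<times> {..t})"
    proof (rule tendsto_lowerbound[OF represents_tendsto[OF N ray_limit_at_right ray_limit_at_right]])
      show "\<forall>\<^sub>F p in at_right s \<times>\<^sub>F at_right t. K (s, t) \<le> K p"
        unfolding eventually_prod_filter
        by (rule exI[of _ "\<lambda>x. s < x"], rule exI[of _ "\<lambda>x. t < x"])
           (auto simp: eventually_at_filter intro!: distribution_like_mono[OF K])
    qed (simp add: prod_filter_eq_bot trivial_limit_at_right_real)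
    also have "\<dots> \<le> measure N (quadrant s t \<union> (fst -` {s} \<union> snd -` {t}))"
    proof (rule finite_measure_mono)
      show "{..s} \<times> {..t} \<subseteq> quadrant s t \<union> (fst -` {s} \<union> snd -` {t})" by (auto simp: quadrant_def)
    qed (use sing in \<open>auto simp: N'(2)\<close>)
    also have "\<dots> \<le> measure N (quadrant s t) + measure N (fst -` {s} \<union> snd -` {t})"
      using sing by (intro measure_Un_le) (auto simp: N'(2))
    also have "measure N (fst -` {s} \<union> snd -` {t}) \<le> measure N (fst -` {s}) + measure N (snd -` {t})"
      using sing
      by (intro measure_Un_le) auto
    finally show "K (s, t) \<le> measure N (quadrant s t)"
      using atom[OF s N'(2)] atom'[OF t N'(2)] by simp
  qed (rule representsD(4)[OF N])
  define S T where "S = D N1 fst \<union> D N2 fst" and "T = D N1 snd \<union> D N2 snd"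
  have "countable S" "countable T"
    unfolding S_def T_def
    by (auto intro!: cD N1.finite_measure_axioms N2.finite_measure_axioms projections_measurable)
  moreover have "negligible ({x} \<times> UNIV :: (real \<times> real) set)" "negligible (UNIV \<times> {x} :: (real \<times> real) set)" for x :: real
  proof -
    have "{x} \<times> UNIV = {p :: real \<times> real. (1, 0) \<bullet> p = x}" "UNIV \<times> {x} = {p :: real \<times> real. (0, 1) \<bullet> p = x}"
      by (auto simp: inner_prod_def)
    then show "negligible ({x} \<times> UNIV :: (real \<times> real) set)" "negligible (UNIV \<times> {x} :: (real \<times> real) set)"
      by (auto intro!: negligible_hyperplane)
  qed
  ultimately have "negligible ((\<Union>x\<in>S. {x} \<times> UNIV) \<union> (\<Union>x\<in>T. UNIV \<times> {x}))"
    by (intro negligible_Un negligible_countable_Union) auto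
  then show ?thesis
  proof (rule negligible_subset)
    have "f (s, t) = measure N1 (quadrant s t) - measure N2 (quadrant s t)" if "s \<notin> S" "t \<notin> T" for s t
      using that eq[OF N1 G, of s t] eq[OF N2 H, of s t] by (simp add: S_def T_def f_eq)
    then show "{(s, t). f (s, t) \<noteq> measure N1 (quadrant s t) - measure N2 (quadrant s t)}
        \<subseteq> (\<Union>x\<in>S. {x} \<times> UNIV) \<union> (\<Union>x\<in>T. UNIV \<times> {x})"
      by blast
  qed
qed

end

subsection \<open>Integrals of product kernels\<close>

lemma integral_lborel_product:
  fixes a b :: "real \<Rightarrow> complex"
  assumes a: "integrable lborel a" and b: "integrable lborel b"
  shows "integral\<^sup>L lborel (\<lambda>p. a (fst p) * b (snd p)) = integral\<^sup>L lborel a * integral\<^sup>L lborel b"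
proof -
  have [measurable]: "a \<in> borel_measurable borel" "b \<in> borel_measurable borel" using a b by auto
  have int: "integrable (lborel \<Otimes>\<^sub>M lborel) (\<lambda>(s, t). a s * b t)"
  proof (rule lborel_pair.Fubini_integrable)
    show "integrable lborel (\<lambda>x. LINT y|lborel. norm (case (x, y) of (s, t) \<Rightarrow> a s * b t))"
      using a by (simp add: norm_mult)
    show "AE x in lborel. integrable lborel (\<lambda>y. case (x, y) of (s, t) \<Rightarrow> a s * b t)"
      using b by simp
  qed measurable
  have "integral\<^sup>L lborel (\<lambda>p. a (fst p) * b (snd p)) = integral\<^sup>L (lborel \<Otimes>\<^sub>M lborel) (\<lambda>(s, t). a s * b t)"
    by (simp add: lborel_prod case_prod_unfold)
  also have "\<dots> = (LINT s|lborel. LINT t|lborel. a s * b t)"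
    using lborel_pair.integral_fst'[OF int] by simp
  also have "\<dots> = integral\<^sup>L lborel a * integral\<^sup>L lborel b"
    by simp
  finally show ?thesis .
qed

lemma set_integrable_bounded:
  fixes k :: "real \<Rightarrow> complex"
  assumes A: "A \<in> sets borel" "emeasure lborel A < \<infinity>"
    and k: "k \<in> borel_measurable borel" "\<And>s. s \<in> A \<Longrightarrow> norm (k s) \<le> B"
  shows "set_integrable lborel A k"
  unfolding set_integrable_def
proof (rule Bochner_Integration.integrable_bound)
  show "integrable lborel (\<lambda>s. indicator A s * B)"
    using A by (intro integrable_mult_left integrable_real_indicator) auto
  show "(\<lambda>x. indicator A x *\<^sub>R k x) \<in> borel_measurable lborel" using A k by simp
  show "AE x in lborel. norm (indicator A x *\<^sub>R k x) \<le> norm (indicator A x * B)"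
    using k(2) by (intro AE_I2) (auto simp: indicator_def intro: order_trans[OF _ abs_ge_self])
qed

text \<open>The kernels are bounded and both measures are finite on the domain, so the integrand is
  absolutely integrable; after the exchange the planar integral splits into one factor per
  coordinate. The form covers both the rectangles of the transform and the frequency regions of the
  inversion.\<close>

lemma product_kernel_Fubini:
  fixes k1 k2 :: "real \<Rightarrow> real \<Rightarrow> complex"
  assumes N: "finite_measure N" "sets N = sets borel"
    and A1: "A1 \<in> sets borel" "emeasure lborel A1 < \<infinity>"
    and A2: "A2 \<in> sets borel" "emeasure lborel A2 < \<infinity>"
    and k1: "(\<lambda>(s, u). k1 s u) \<in> borel_measurable (borel \<Otimes>\<^sub>M borel)" "\<And>s u. s \<in> A1 \<Longrightarrow> norm (k1 s u) \<le> B1"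
    and k2: "(\<lambda>(s, u). k2 s u) \<in> borel_measurable (borel \<Otimes>\<^sub>M borel)" "\<And>s u. s \<in> A2 \<Longrightarrow> norm (k2 s u) \<le> B2"
  shows "set_integrable lborel (A1 \<times> A2) (\<lambda>q. \<integral>p. k1 (fst q) (fst p) * k2 (snd q) (snd p) \<partial>N)"
    and "(LINT q:A1 \<times> A2|lborel. \<integral>p. k1 (fst q) (fst p) * k2 (snd q) (snd p) \<partial>N) =
      (\<integral>p. (LINT s:A1|lborel. k1 s (fst p)) * (LINT t:A2|lborel. k2 t (snd p)) \<partial>N)"
proof -
  interpret N: finite_measure N by fact
  interpret P: pair_sigma_finite "lborel :: (real \<times> real) measure" N
    by (intro pair_sigma_finite.intro sigma_finite_lborel N.sigma_finite_measure_axioms)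
  note [measurable] = A1(1) A2(1)
  have [measurable_cong]: "sets N = sets (borel \<Otimes>\<^sub>M borel)" unfolding borel_prod by (rule N(2))
  have sl [measurable_cong]: "sets (lborel :: (real \<times> real) measure) = sets (borel \<Otimes>\<^sub>M borel)" unfolding borel_prod by simp
  have m1 [measurable]: "(\<lambda>x. k1 (g x) (h x)) \<in> borel_measurable M"
    if "g \<in> borel_measurable M" "h \<in> borel_measurable M" for M :: "'x measure" and g h
    using measurable_compose[OF measurable_Pair[OF that] k1(1)] by simp
  have m2 [measurable]: "(\<lambda>x. k2 (g x) (h x)) \<in> borel_measurable M"
    if "g \<in> borel_measurable M" "h \<in> borel_measurable M" for M :: "'x measure" and g h
    using measurable_compose[OF measurable_Pair[OF that] k2(1)] by simp
  have A12 [measurable]: "A1 \<times> A2 \<in> sets (borel \<Otimes>\<^sub>M borel)" by (intro pair_measureI A1 A2)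
  have fin: "emeasure lborel (A1 \<times> A2) < \<infinity>"
    unfolding lborel_prod[symmetric] using A1 A2
    by (subst lborel.emeasure_pair_measure_Times) (auto simp: ennreal_mult_less_top)
  define F where "F q p = indicator (A1 \<times> A2) q *\<^sub>R (k1 (fst q) (fst p) * k2 (snd q) (snd p))" for q p
  have F_meas: "(\<lambda>(q, p). F q p) \<in> borel_measurable (lborel \<Otimes>\<^sub>M N)"
    unfolding F_def by measurable
  have int: "integrable (lborel \<Otimes>\<^sub>M N) (\<lambda>(q, p). F q p)"
  proof (rule Bochner_Integration.integrable_bound[OF _ F_meas])
    show "integrable (lborel \<Otimes>\<^sub>M N) (\<lambda>z. indicator ((A1 \<times> A2) \<times> space N) z * (B1 * B2 :: real))"
    proof (intro integrable_mult_left integrable_real_indicator)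
      show "(A1 \<times> A2) \<times> space N \<in> sets (lborel \<Otimes>\<^sub>M N)" 
        using A12 unfolding borel_prod by (intro pair_measureI) auto
      have "emeasure (lborel \<Otimes>\<^sub>M N) ((A1 \<times> A2) \<times> space N) = emeasure lborel (A1 \<times> A2) * emeasure N (space N)"
        using A12 unfolding borel_prod by (intro N.emeasure_pair_measure_Times) auto
      moreover have "emeasure N (space N) < top" by (simp add: less_top[symmetric])
      ultimately show "emeasure (lborel \<Otimes>\<^sub>M N) ((A1 \<times> A2) \<times> space N) < \<infinity>"
        using fin by (simp add: ennreal_mult_less_top)
    qed
    have "norm (k1 s u * k2 t v) \<le> norm (B1 * B2)" if "s \<in> A1" "t \<in> A2" for s t u v
    proof -
      have "norm (k1 s u * k2 t v) \<le> B1 * B2"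
        unfolding norm_mult using k1(2)[OF that(1), of u] k2(2)[OF that(2), of v]
        by (intro mult_mono) (auto intro: order_trans[OF norm_ge_zero])
      then show ?thesis by simp
    qed
    then show "AE z in lborel \<Otimes>\<^sub>M N. norm (case z of (q, p) \<Rightarrow> F q p)
        \<le> norm (indicator ((A1 \<times> A2) \<times> space N) z * (B1 * B2))"
      by (intro AE_I2) (auto simp: F_def space_pair_measure indicator_def)
  qed
  have F_int: "(\<integral>p. F q p \<partial>N) = indicator (A1 \<times> A2) q *\<^sub>R (\<integral>p. k1 (fst q) (fst p) * k2 (snd q) (snd p) \<partial>N)" for q
    by (simp add: F_def)
  show "set_integrable lborel (A1 \<times> A2) (\<lambda>q. \<integral>p. k1 (fst q) (fst p) * k2 (snd q) (snd p) \<partial>N)"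
    using P.integrable_fst'[OF int] by (simp add: set_integrable_def F_int)
  have i1: "integrable lborel (\<lambda>s. indicator A1 s *\<^sub>R k1 s u)" for u
    using set_integrable_bounded[OF A1, of "\<lambda>s. k1 s u" B1] k1(2) by (simp add: set_integrable_def)
  have i2: "integrable lborel (\<lambda>s. indicator A2 s *\<^sub>R k2 s u)" for u
    using set_integrable_bounded[OF A2, of "\<lambda>s. k2 s u" B2] k2(2) by (simp add: set_integrable_def)
  have inner: "(\<integral>q. F q p \<partial>lborel) = (LINT s:A1|lborel. k1 s (fst p)) * (LINT t:A2|lborel. k2 t (snd p))" for p
  proof -
    have "F q p = (indicator A1 (fst q) *\<^sub>R k1 (fst q) (fst p)) * (indicator A2 (snd q) *\<^sub>R k2 (snd q) (snd p))" for q
      by (cases q) (auto simp: F_def indicator_def)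
    then show ?thesis
      unfolding set_lebesgue_integral_def by (simp only: integral_lborel_product[OF i1 i2])
  qed
  have "(LINT q:A1 \<times> A2|lborel. \<integral>p. k1 (fst q) (fst p) * k2 (snd q) (snd p) \<partial>N) = (\<integral>q. (\<integral>p. F q p \<partial>N) \<partial>lborel)"
    by (simp add: set_lebesgue_integral_def F_int)
  also have "\<dots> = (\<integral>p. (\<integral>q. F q p \<partial>lborel) \<partial>N)"
    using P.Fubini_integral[OF int] by simp
  also have "\<dots> = (\<integral>p. (LINT s:A1|lborel. k1 s (fst p)) * (LINT t:A2|lborel. k2 t (snd p)) \<partial>N)"
    unfolding inner ..
  finally show "(LINT q:A1 \<times> A2|lborel. \<integral>p. k1 (fst q) (fst p) * k2 (snd q) (snd p) \<partial>N) =
      (\<integral>p. (LINT s:A1|lborel. k1 s (fst p)) * (LINT t:A2|lborel. k2 t (snd p)) \<partial>N)" .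
qed


section \<open>Explicit one-dimensional integrals\<close>

text \<open>\<open>m\<close> is \<open>u\<close> clamped to the interval, the point from which the
  ray contributes: everything if \<open>u \<le> a\<close>, nothing if \<open>b \<le> u\<close>. With
  one formula for all positions of \<open>u\<close>, the boundary term at \<open>b\<close> is a
  constant in \<open>u\<close>, as \<open>J_shift\<close> will require.\<close>

lemma has_integral_exp_ray:
  fixes \<xi> a b u :: real
  assumes \<xi>: "\<xi> \<noteq> 0" and ab: "a \<le> b"
  defines "m \<equiv> min b (max a u)"
  shows "((\<lambda>s. if u < s then exp (- (\<i> * of_real (\<xi> * s))) else 0) has_integral
    (exp (- (\<i> * of_real (\<xi> * m))) - exp (- (\<i> * of_real (\<xi> * b)))) / (\<i> * of_real \<xi>)) {a..b}"
    (is "(?f has_integral ?I) _")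
proof -
  let ?e = "\<lambda>s. exp (- (\<i> * of_real (\<xi> * s))) :: complex"
  have ii: "- (\<i> * (E * \<i>)) = E" for E
  proof -
    have "- (\<i> * (E * \<i>)) = - (\<i> * \<i> * E)" by (simp only: ac_simps)
    then show ?thesis by simp
  qed
  have m: "a \<le> m" "m \<le> b" using ab by (auto simp: m_def)
  have "(?e has_integral ((- ?e b / (\<i> * of_real \<xi>)) - (- ?e m / (\<i> * of_real \<xi>)))) {m..b}"
  proof (rule fundamental_theorem_of_calculus[OF m(2)])
    fix s
    have "((\<lambda>z. - exp (- (\<i> * (of_real \<xi> * z))) / (\<i> * of_real \<xi>)) has_field_derivative ?e s) (at (of_real s))"
      using \<xi> by (auto intro!: derivative_eq_intros simp: ii)
    from has_vector_derivative_real_field[OF this]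
    show "((\<lambda>s. - ?e s / (\<i> * of_real \<xi>)) has_vector_derivative ?e s) (at s within {m..b})"
      by simp
  qed
  then have "(?e has_integral ?I) {m..b}" by (simp add: diff_divide_distrib)
  then have "(?f has_integral ?I) {m..b}"
    by (rule has_integral_spike_finite[of "{m}", rotated -1])
       (auto simp: m_def min_def max_def split: if_splits)
  moreover have "(?f has_integral 0) {a..m}"
    by (rule has_integral_spike_finite[OF _ _ has_integral_0, of "{m}"])
       (auto simp: m_def min_def max_def split: if_splits)
  ultimately have "(?f has_integral (0 + ?I)) {a..b}"
    by (intro has_integral_combine[OF m])
  then show ?thesis by simp
qed

text \<open>Pairing \<open>\<xi>\<close> with \<open>- \<xi>\<close> cancels the cosine, which is
  odd after division by \<open>\<xi>\<close>, and leaves \<open>2 * sin (\<xi> * z) / \<xi>\<close>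
  with primitive \<open>2 * Si (\<xi> * z)\<close>.\<close>

lemma has_integral_exp_div_symmetric:
  fixes z \<alpha> \<beta> :: real
  assumes "0 < \<alpha>" "\<alpha> < \<beta>"
  defines "A \<equiv> {\<xi>. \<alpha> \<le> \<bar>\<xi>\<bar> \<and> \<bar>\<xi>\<bar> \<le> \<beta>}"
  shows "((\<lambda>\<xi>. exp (\<i> * of_real (z * \<xi>)) / (\<i> * of_real \<xi>)) has_integral
    complex_of_real (2 * (Si (\<beta> * z) - Si (\<alpha> * z)))) A"
proof -
  let ?c = "\<lambda>\<xi>. exp (\<i> * of_real (z * \<xi>)) / (\<i> * of_real \<xi>) :: complex"
  have int: "?c integrable_on {\<alpha>..\<beta>}" "?c integrable_on {-\<beta>..-\<alpha>}"
    using assms(1,2) by (intro integrable_continuous_real continuous_intros; auto)+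
  have A: "A = {-\<beta>..-\<alpha>} \<union> {\<alpha>..\<beta>}" using assms(1,2) by (auto simp: A_def)
  have refl: "((\<lambda>\<xi>. ?c (- \<xi>)) has_integral integral {-\<beta>..-\<alpha>} ?c) {\<alpha>..\<beta>}"
    using has_integral_reflect_real[where f = ?c and a = "-\<beta>" and b = "-\<alpha>", THEN iffD2, OF integrable_integral[OF int(2)]]
    unfolding minus_minus .
  have sum: "?c \<xi> + ?c (- \<xi>) = complex_of_real (2 * sin (\<xi> * z) / \<xi>)" for \<xi>
  proof (cases "\<xi> = 0")
    case False
    have "complex_of_real (2 * sin (\<xi> * z) / \<xi>) = 2 * sin (of_real (z * \<xi>)) / of_real \<xi>"
      unfolding sin_of_real by (simp add: mult.commute)
    also have "\<dots> = (exp (\<i> * of_real (z * \<xi>)) - exp (- (\<i> * of_real (z * \<xi>)))) / \<i> / of_real \<xi>"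
      unfolding sin_exp_eq by simp
    also have "\<dots> = (exp (\<i> * of_real (z * \<xi>)) - exp (- (\<i> * of_real (z * \<xi>)))) / (\<i> * of_real \<xi>)"
      by (simp only: divide_divide_eq_left)
    finally show ?thesis by (simp add: diff_divide_distrib)
  qed simp
  have "((\<lambda>\<xi>. 2 * sin (\<xi> * z) / \<xi>) has_integral (2 * Si (\<beta> * z) - 2 * Si (\<alpha> * z))) {\<alpha>..\<beta>}"
  proof (rule fundamental_theorem_of_calculus)
    fix \<xi> assume "\<xi> \<in> {\<alpha>..\<beta>}"
    then have "\<xi> \<noteq> 0" using assms(1,2) by auto
    then have "((\<lambda>\<xi>. 2 * Si (\<xi> * z)) has_real_derivative (2 * sin (\<xi> * z) / \<xi>)) (at \<xi>)"
      by (auto intro!: derivative_eq_intros DERIV_chain2[OF DERIV_Si])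
    then show "((\<lambda>\<xi>. 2 * Si (\<xi> * z)) has_vector_derivative (2 * sin (\<xi> * z) / \<xi>)) (at \<xi> within {\<alpha>..\<beta>})"
      by (simp add: has_real_derivative_iff_has_vector_derivative has_vector_derivative_at_within)
  qed (use assms(1,2) in auto)
  then have 1: "((\<lambda>\<xi>. complex_of_real (2 * sin (\<xi> * z) / \<xi>)) has_integral
      complex_of_real (2 * Si (\<beta> * z) - 2 * Si (\<alpha> * z))) {\<alpha>..\<beta>}"
    by (rule has_integral_of_real)
  have 2: "((\<lambda>\<xi>. complex_of_real (2 * sin (\<xi> * z) / \<xi>)) has_integral
      integral {\<alpha>..\<beta>} ?c + integral {-\<beta>..-\<alpha>} ?c) {\<alpha>..\<beta>}"
    by (rule has_integral_eq[OF sum has_integral_add[OF integrable_integral[OF int(1)] refl]])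
  have eq: "integral {\<alpha>..\<beta>} ?c + integral {-\<beta>..-\<alpha>} ?c = complex_of_real (2 * Si (\<beta> * z) - 2 * Si (\<alpha> * z))"
    by (rule has_integral_unique[OF 2 1])
  have "(?c has_integral integral {-\<beta>..-\<alpha>} ?c + integral {\<alpha>..\<beta>} ?c) ({-\<beta>..-\<alpha>} \<union> {\<alpha>..\<beta>})"
    using assms(1,2) by (intro has_integral_Un integrable_integral int negligible_subset[OF negligible_empty]) auto
  then show ?thesis unfolding A eq[symmetric] right_diff_distrib by (simp only: add.commute)
qed

text \<open>The case \<open>z = 0\<close> matters: the value 0 of \<open>sgn\<close> there is what
  weights open and closed rays equally in the final formula.\<close>

lemma Si_limits:
  fixes z :: real
  shows "((\<lambda>(\<alpha>, \<beta>). 2 * (Si (\<beta> * z) - Si (\<alpha> * z))) \<longlongrightarrow> pi * sgn z) (at_right 0 \<times>\<^sub>F at_top)"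
proof -
  have "((\<lambda>\<alpha>. \<alpha> * z) \<longlongrightarrow> 0) (at_right 0)" by (auto intro!: tendsto_eq_intros)
  from isCont_tendsto_compose[OF isCont_Si this] have 0: "((\<lambda>\<alpha>. Si (\<alpha> * z)) \<longlongrightarrow> 0) (at_right 0)"
    by (simp add: Si_alt_def zero_ereal_def[symmetric])
  have top: "((\<lambda>\<beta>. Si (\<beta> * z)) \<longlongrightarrow> pi / 2 * sgn z) at_top"
  proof (cases z "0 :: real" rule: linorder_cases)
    case greater
    have "filterlim (\<lambda>\<beta>. \<beta> * z) at_top at_top"
      using greater by (intro filterlim_at_top_mult_tendsto_pos[OF tendsto_const] filterlim_ident) auto
    from filterlim_compose[OF Si_at_top this] show ?thesis using greater by simp
  next
    case equal
    then show ?thesis by (simp add: Si_alt_def zero_ereal_def[symmetric])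
  next
    case less
    have "filterlim (\<lambda>\<beta>. \<beta> * (- z)) at_top at_top"
      using less by (intro filterlim_at_top_mult_tendsto_pos[OF tendsto_const] filterlim_ident) auto
    from tendsto_minus[OF filterlim_compose[OF Si_at_top this]]
    have "((\<lambda>\<beta>. - Si (\<beta> * (- z))) \<longlongrightarrow> pi / 2 * sgn z) at_top" using less by simp
    moreover have "\<forall>\<^sub>F \<beta> in at_top. - Si (\<beta> * (- z)) = Si (\<beta> * z)"
      using eventually_ge_at_top[of 0]
    proof eventually_elim
      case (elim \<beta>)
      then have "0 \<le> \<beta> * (- z)" using less by (simp add: mult_nonneg_nonpos)
      from Si_neg[OF this] show ?case by simp
    qed
    ultimately show ?thesis by (rule Lim_transform_eventually)
  qed
  have "((\<lambda>p. 2 * (Si (snd p * z) - Si (fst p * z))) \<longlongrightarrow> 2 * (pi / 2 * sgn z - 0)) (at_right 0 \<times>\<^sub>F at_top)"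
    by (intro tendsto_intros filterlim_compose[OF top filterlim_snd] filterlim_compose[OF 0 filterlim_fst])
  then show ?thesis by (simp add: case_prod_unfold)
qed

subsection \<open>The transform and its inversion\<close>

context represented_function
begin

lemma J_Fubini:
  fixes k1 k2 :: "real \<Rightarrow> real \<Rightarrow> complex"
  assumes "A1 \<in> sets borel" "emeasure lborel A1 < \<infinity>" "A2 \<in> sets borel" "emeasure lborel A2 < \<infinity>"
    and "(\<lambda>(s, u). k1 s u) \<in> borel_measurable (borel \<Otimes>\<^sub>M borel)" "\<And>s u. s \<in> A1 \<Longrightarrow> norm (k1 s u) \<le> C"
    and "(\<lambda>(s, u). k2 s u) \<in> borel_measurable (borel \<Otimes>\<^sub>M borel)" "\<And>s u. s \<in> A2 \<Longrightarrow> norm (k2 s u) \<le> D"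
  shows "((\<lambda>q. J (\<lambda>p. k1 (fst q) (fst p) * k2 (snd q) (snd p))) has_integral
    J (\<lambda>p. (LINT s:A1|lborel. k1 s (fst p)) * (LINT t:A2|lborel. k2 t (snd p)))) (A1 \<times> A2)"
proof -
  note 1 = product_kernel_Fubini[OF N1.finite_measure_axioms sets_N(1) assms]
  note 2 = product_kernel_Fubini[OF N2.finite_measure_axioms sets_N(2) assms]
  have "set_integrable lborel (A1 \<times> A2) (\<lambda>q. J (\<lambda>p. k1 (fst q) (fst p) * k2 (snd q) (snd p)))"
    unfolding J_def by (rule set_integral_diff(1)[OF 1(1) 2(1)])
  note I = set_borel_integral_eq_integral[OF this]
  have "(LINT q:A1 \<times> A2|lborel. J (\<lambda>p. k1 (fst q) (fst p) * k2 (snd q) (snd p))) =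
      (LINT q:A1 \<times> A2|lborel. \<integral>p. k1 (fst q) (fst p) * k2 (snd q) (snd p) \<partial>N1) -
      (LINT q:A1 \<times> A2|lborel. \<integral>p. k1 (fst q) (fst p) * k2 (snd q) (snd p) \<partial>N2)"
    unfolding J_def by (rule set_integral_diff(2)[OF 1(1) 2(1)])
  also have "\<dots> = J (\<lambda>p. (LINT s:A1|lborel. k1 s (fst p)) * (LINT t:A2|lborel. k2 t (snd p)))"
    unfolding J_def by (rule arg_cong2[where f = minus, OF 1(2) 2(2)])
  finally show ?thesis using integrable_integral[OF I(1)] unfolding I(2) by simp
qed

lemma J_divide: "J (\<lambda>p. g p / c) = J g / c"
  by (simp add: J_def diff_divide_distrib)

lemma J_indicator:
  assumes "A \<in> sets borel"
  shows "J (\<lambda>p. of_real (indicator A p)) = of_real (measure N1 A - measure N2 A)"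
  using assms unfolding J_def integral_complex_of_real by simp

lemma admissible_fst_snd:
  assumes "g \<in> borel_measurable borel" "\<And>u. norm (g u) \<le> B"
  shows "admissible (\<lambda>p. g (fst p))" "admissible (\<lambda>p. g (snd p))"
  using assms measurable_compose[OF projections_measurable(1)[OF refl]]
    measurable_compose[OF projections_measurable(2)[OF refl]]
  by (auto simp: admissible_def)

lemma admissible_mult:
  assumes "admissible g" "admissible h"
  shows "admissible (\<lambda>p. g p * h p)"
proof -
  obtain B C where "g \<in> borel_measurable borel" "\<And>p. norm (g p) \<le> B" "h \<in> borel_measurable borel" "\<And>p. norm (h p) \<le> C"
    using assms by (auto simp: admissible_def)
  moreover from this have "norm (g p * h p) \<le> B * C" for p
    unfolding norm_mult by (intro mult_mono) (auto intro: order_trans[OF norm_ge_zero])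
  ultimately show ?thesis by (auto simp: admissible_def)
qed

text \<open>The marginals of the signed measure vanish, so additive constants in the factors do not matter.\<close>

lemma J_shift:
  fixes g h :: "real \<Rightarrow> complex"
  assumes g: "g \<in> borel_measurable borel" "\<And>u. norm (g u) \<le> B"
    and h: "h \<in> borel_measurable borel" "\<And>u. norm (h u) \<le> C"
  shows "J (\<lambda>p. (g (fst p) - c) * (h (snd p) - d)) = J (\<lambda>p. g (fst p) * h (snd p))"
proof -
  have const: "admissible (\<lambda>_. z)" for z by (auto simp: admissible_def)
  have gh: "admissible (\<lambda>p. g (fst p) * h (snd p))"
    by (intro admissible_mult admissible_fst_snd[OF g] admissible_fst_snd[OF h])
  have "J (\<lambda>p. (g (fst p) - c) * (h (snd p) - d)) =
      J (\<lambda>p. (g (fst p) * h (snd p) - d * g (fst p)) - c * (h (snd p) - d))"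
    by (simp add: algebra_simps)
  also have "\<dots> = J (\<lambda>p. g (fst p) * h (snd p)) - J (\<lambda>p. d * g (fst p)) - J (\<lambda>p. c * (h (snd p) - d))"
  proof -
    have a: "admissible (\<lambda>p. d * g (fst p))" by (intro admissible_mult const admissible_fst_snd[OF g])
    have "admissible (\<lambda>p. h (snd p) - d)"
    proof (rule admissible_fst_snd)
      show "norm (h u - d) \<le> C + norm d" for u
        using h(2)[of u] norm_triangle_ineq4[of "h u" d] by simp
    qed (use h in simp)
    then have b: "admissible (\<lambda>p. c * (h (snd p) - d))" by (intro admissible_mult const)
    have "admissible (\<lambda>p. g (fst p) * h (snd p) - d * g (fst p))"
    proof -
      have "admissible (\<lambda>p. g (fst p) * (h (snd p) - d))"
        using \<open>admissible (\<lambda>p. h (snd p) - d)\<close> by (intro admissible_mult admissible_fst_snd[OF g])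
      then show ?thesis by (simp add: algebra_simps)
    qed
    then show ?thesis by (simp add: J_diff a b gh)
  qed
  also have "J (\<lambda>p. d * g (fst p)) = 0" using g by (intro J_marginal(1)) simp
  also have "J (\<lambda>p. c * (h (snd p) - d)) = 0" using h by (intro J_marginal(2)[of "\<lambda>v. c * (h v - d)"]) simp
  finally show ?thesis by simp
qed

section \<open>The transform as a Fourier-Stieltjes transform\<close>

definition wave :: "real \<Rightarrow> real \<Rightarrow> complex" where
  "wave \<xi> s = exp (- (\<i> * of_real (\<xi> * s)))"

lemma norm_wave [simp]: "norm (wave \<xi> s) = 1"
  unfolding wave_def using norm_exp_i_times[of "- (\<xi> * s)"] by simp

lemma wave_measurable [measurable]: "wave \<xi> \<in> borel_measurable borel"
  unfolding wave_def[abs_def] by measurable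

lemma set_integral_wave:
  assumes "\<xi> \<noteq> 0" "a \<le> b"
  shows "(LINT s:{a..b}|lborel. if u < s then wave \<xi> s else 0) =
    (wave \<xi> (min b (max a u)) - wave \<xi> b) / (\<i> * of_real \<xi>)"
proof -
  have "set_integrable lborel {a..b} (\<lambda>s. if u < s then wave \<xi> s else 0)"
    by (rule set_integrable_bounded[where B = 1]) (auto simp: emeasure_lborel_Icc_eq)
  from set_borel_integral_eq_integral(2)[OF this] show ?thesis
    using integral_unique[OF has_integral_exp_ray[OF assms, of u, folded wave_def]] by simp
qed

text \<open>Off a negligible set f is the signed mass of a quadrant, that is \<open>J\<close> of an
  indicator that factors into \<open>u < s\<close> and \<open>v < t\<close>. Hence the integrand is
  \<open>J\<close> of a product kernel.\<close>

lemma fourier_integrand_has_integral: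
  "(fourier_integrand f \<xi> \<eta> has_integral
    J (\<lambda>p. (LINT s:{a..b}|lborel. if fst p < s then wave \<xi> s else 0) *
      (LINT t:{c..d}|lborel. if snd p < t then wave \<eta> t else 0))) (cbox (a, c) (b, d))"
proof -
  let ?g = "\<lambda>q. J (\<lambda>p. (if fst p < fst q then wave \<xi> (fst q) else 0) * (if snd p < snd q then wave \<eta> (snd q) else 0))"
  have meas: "(\<lambda>(s, u). if u < s then wave z s else 0) \<in> borel_measurable (borel \<Otimes>\<^sub>M borel)" for z
    unfolding case_prod_unfold by measurable
  have int: "(?g has_integral J (\<lambda>p. (LINT s:{a..b}|lborel. if fst p < s then wave \<xi> s else 0) *
      (LINT t:{c..d}|lborel. if snd p < t then wave \<eta> t else 0))) ({a..b} \<times> {c..d})"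
    by (rule J_Fubini[OF _ _ _ _ meas _ meas, where C = 1 and D = 1]) (auto simp: emeasure_lborel_Icc_eq)
  have box: "{a..b} \<times> {c..d} = cbox (a, c) (b, d)" by (simp add: cbox_Pair_eq)
  have eq: "fourier_integrand f \<xi> \<eta> q = ?g q"
    if "q \<notin> {(s, t). f (s, t) \<noteq> measure N1 (quadrant s t) - measure N2 (quadrant s t)}" for q
  proof -
    obtain s t where q: "q = (s, t)" by (cases q)
    have "?g q = J (\<lambda>p. (wave \<xi> s * wave \<eta> t) * of_real (indicator (quadrant s t) p))"
      unfolding q by (rule arg_cong[where f = J]) (auto simp: fun_eq_iff quadrant_def indicator_def)
    also have "\<dots> = (wave \<xi> s * wave \<eta> t) * of_real (measure N1 (quadrant s t) - measure N2 (quadrant s t))"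
      by (simp only: J_cmult J_indicator[OF quadrant_sets])
    also have "measure N1 (quadrant s t) - measure N2 (quadrant s t) = f (s, t)"
      using that by (simp add: q)
    also have "wave \<xi> s * wave \<eta> t = exp (- (\<i> * of_real (\<xi> * s + \<eta> * t)))"
      by (simp add: wave_def exp_add[symmetric] algebra_simps)
    also have "\<dots> * of_real (f (s, t)) = fourier_integrand f \<xi> \<eta> q"
      by (simp add: q fourier_integrand_def)
    finally show ?thesis ..
  qed
  show ?thesis
    by (rule has_integral_spike[OF negligible_discontinuities eq int[unfolded box]]) simp
qed

definition transform :: "real \<Rightarrow> real \<Rightarrow> complex" where
  "transform \<xi> \<eta> = J (\<lambda>p. wave \<xi> (fst p) * wave \<eta> (snd p)) / ((\<i> * of_real \<xi>) * (\<i> * of_real \<eta>))"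

lemma has_KP_fourier_transform:
  assumes "\<xi> \<noteq> 0" "\<eta> \<noteq> 0"
  shows "has_KP_fourier f \<xi> \<eta> (transform \<xi> \<eta>)"
  unfolding has_KP_fourier_def
proof (intro conjI allI)
  show "fourier_integrand f \<xi> \<eta> integrable_on cbox (a, c) (b, d)" for a b c d
    using fourier_integrand_has_integral by (rule has_integral_integrable)
  let ?F = "(at_bot :: real filter) \<times>\<^sub>F (at_top :: real filter) \<times>\<^sub>F (at_bot :: real filter) \<times>\<^sub>F (at_top :: real filter)"
  let ?h = "\<lambda>i p. wave \<xi> (min (fst (snd i)) (max (fst i) (fst p))) *
    wave \<eta> (min (snd (snd (snd i))) (max (fst (snd (snd i))) (snd p)))"
  have ev: "\<forall>\<^sub>F i in ?F. fst i \<le> a \<and> b \<le> fst (snd i) \<and> fst (snd (snd i)) \<le> c \<and> d \<le> snd (snd (snd i))" for a b c d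
    using eventually_prodI[OF eventually_le_at_bot[of a] eventually_prodI[OF eventually_ge_at_top[of b]
      eventually_prodI[OF eventually_le_at_bot[of c] eventually_ge_at_top[of d]]]] by simp
  have "((\<lambda>i. J (?h i)) \<longlongrightarrow> J (\<lambda>p. wave \<xi> (fst p) * wave \<eta> (snd p))) ?F"
  proof (rule J_tendsto[where B = 1])
    show "countably_generated ?F" by (intro countably_generated_prod countably_generated_real)
    have [measurable]: "(fst :: real \<times> real \<Rightarrow> real) \<in> borel_measurable borel" "(snd :: real \<times> real \<Rightarrow> real) \<in> borel_measurable borel"
      by (auto intro: projections_measurable)
    show "\<forall>\<^sub>F i in ?F. ?h i \<in> borel_measurable borel \<and> (\<forall>p. norm (?h i p) \<le> 1)"
      by (intro always_eventually allI conjI) (measurable, simp add: norm_mult)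
    show "(\<lambda>p. wave \<xi> (fst p) * wave \<eta> (snd p)) \<in> borel_measurable borel" by measurable
    \<comment> \<open>For fixed \<open>p\<close> the clamps are eventually the identity.\<close>
    show "((\<lambda>i. ?h i p) \<longlongrightarrow> wave \<xi> (fst p) * wave \<eta> (snd p)) ?F" for p
      by (rule tendsto_eventually)
         (use ev[of "fst p" "fst p" "snd p" "snd p"] in \<open>auto elim!: eventually_mono simp: min_def max_def\<close>)
  qed
  then have "((\<lambda>i. J (?h i) / ((\<i> * of_real \<xi>) * (\<i> * of_real \<eta>))) \<longlongrightarrow> transform \<xi> \<eta>) ?F"
    unfolding transform_def by (intro tendsto_divide tendsto_const) (use assms in auto)
  moreover have "\<forall>\<^sub>F i in ?F. J (?h i) / ((\<i> * of_real \<xi>) * (\<i> * of_real \<eta>)) =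
      (case i of (a, b, c, d) \<Rightarrow> integral (cbox (a, c) (b, d)) (fourier_integrand f \<xi> \<eta>))"
    \<comment> \<open>Comparing all four end points with 0 yields \<open>a \<le> b\<close> and
      \<open>c \<le> d\<close>.\<close>
    using ev[of 0 0 0 0]
  proof (rule eventually_mono)
    fix i :: "real \<times> real \<times> real \<times> real"
    obtain a b c d where i: "i = (a, b, c, d)" by (metis prod.exhaust)
    assume "fst i \<le> 0 \<and> 0 \<le> fst (snd i) \<and> fst (snd (snd i)) \<le> 0 \<and> 0 \<le> snd (snd (snd i))"
    then have ab: "a \<le> b" "c \<le> d" by (auto simp: i)
    have "integral (cbox (a, c) (b, d)) (fourier_integrand f \<xi> \<eta>) =
        J (\<lambda>p. ((wave \<xi> (min b (max a (fst p))) - wave \<xi> b) / (\<i> * of_real \<xi>)) *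
          ((wave \<eta> (min d (max c (snd p))) - wave \<eta> d) / (\<i> * of_real \<eta>)))"
      using integral_unique[OF fourier_integrand_has_integral[of \<xi> \<eta> a b c d]]
      by (simp only: set_integral_wave[OF assms(1) ab(1)] set_integral_wave[OF assms(2) ab(2)])
    also have "\<dots> = J (\<lambda>p. (wave \<xi> (min b (max a (fst p))) - wave \<xi> b) * (wave \<eta> (min d (max c (snd p))) - wave \<eta> d)) /
        ((\<i> * of_real \<xi>) * (\<i> * of_real \<eta>))"
      by (simp only: times_divide_times_eq J_divide)
    \<comment> \<open>The terms \<open>wave \<xi> b\<close> and \<open>wave \<eta> d\<close>
      oscillate without limit as \<open>b\<close> and \<open>d\<close> grow. They are constant in
      \<open>p\<close>, so the vanishing marginals remove them before the limit is taken.\<close>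
    also have "\<dots> = J (?h i) / ((\<i> * of_real \<xi>) * (\<i> * of_real \<eta>))"
      unfolding i fst_conv snd_conv
      by (subst J_shift[where g = "\<lambda>u. wave \<xi> (min b (max a u))" and h = "\<lambda>u. wave \<eta> (min d (max c u))" and B = 1 and C = 1])
         auto
    finally show "J (?h i) / ((\<i> * of_real \<xi>) * (\<i> * of_real \<eta>)) =
      (case i of (a, b, c, d) \<Rightarrow> integral (cbox (a, c) (b, d)) (fourier_integrand f \<xi> \<eta>))"
      by (simp add: i)
  qed
  ultimately show "((\<lambda>(a, b, c, d). integral (cbox (a, c) (b, d)) (fourier_integrand f \<xi> \<eta>)) \<longlongrightarrow> transform \<xi> \<eta>) ?F"
    by (rule Lim_transform_eventually)
qed

lemma KP_fourier_eq:
  assumes "\<xi> \<noteq> 0" "\<eta> \<noteq> 0"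
  shows "KP_fourier f \<xi> \<eta> = transform \<xi> \<eta>"
  unfolding KP_fourier_def
proof (rule the_equality)
  show "has_KP_fourier f \<xi> \<eta> (transform \<xi> \<eta>)" by (rule has_KP_fourier_transform[OF assms])
  show "z = transform \<xi> \<eta>" if "has_KP_fourier f \<xi> \<eta> z" for z
    using that has_KP_fourier_transform[OF assms] unfolding has_KP_fourier_def
    by (elim conjE) (rule tendsto_unique, auto simp: prod_filter_eq_bot)
qed

section \<open>The truncated inversion integral and its limit\<close>

text \<open>In each coordinate the inversion factor and the wave combine to an exponential in
  \<open>x - u\<close> or \<open>y - v\<close>, so the integrand is \<open>J\<close> of a product of
  kernels \<open>c\<close>. The lower cut-offs bound these by \<open>1 / \<alpha>1\<close> and
  \<open>1 / \<alpha>2\<close>, which justifies the exchange.\<close>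

lemma inversion_integrand_has_integral:
  assumes "0 < \<alpha>1" "\<alpha>1 < \<beta>1" "0 < \<alpha>2" "\<alpha>2 < \<beta>2"
  shows "(inversion_integrand f x y has_integral
    J (\<lambda>p. of_real (2 * (Si (\<beta>1 * (x - fst p)) - Si (\<alpha>1 * (x - fst p))) *
      (2 * (Si (\<beta>2 * (y - snd p)) - Si (\<alpha>2 * (y - snd p)))))))
    (freq_region \<alpha>1 \<alpha>2 \<beta>1 \<beta>2)"
proof -
  define A where "A \<alpha> \<beta> = {\<xi> :: real. \<alpha> \<le> \<bar>\<xi>\<bar> \<and> \<bar>\<xi>\<bar> \<le> \<beta>}" for \<alpha> \<beta>
  define c where "c = (\<lambda>z \<xi> :: real. exp (\<i> * of_real (z * \<xi>)) / (\<i> * of_real \<xi>))"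
  have A_sets: "A \<alpha> \<beta> \<in> sets borel" for \<alpha> \<beta>
    unfolding A_def by (intro borel_closed closed_Collect_conj closed_Collect_le continuous_intros)
  have A_fin: "emeasure lborel (A \<alpha> \<beta>) < \<infinity>" for \<alpha> \<beta>
  proof -
    have "emeasure lborel (A \<alpha> \<beta>) \<le> emeasure lborel {-\<beta>..\<beta>}" by (rule emeasure_mono) (auto simp: A_def)
    also have "\<dots> < \<infinity>" by (simp add: emeasure_lborel_Icc_eq)
    finally show ?thesis .
  qed
  have c_norm: "norm (c z \<xi>) \<le> 1 / \<alpha>" if "0 < \<alpha>" "\<xi> \<in> A \<alpha> \<beta>" for z \<xi> \<alpha> \<beta>
    using that unfolding c_def A_def
    by (auto simp: norm_divide norm_mult intro!: divide_left_mono)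
  have c_meas: "(\<lambda>(\<xi>, u). c (w - u) \<xi>) \<in> borel_measurable (borel \<Otimes>\<^sub>M borel)" for w
    unfolding c_def case_prod_unfold by measurable
  have c_int: "(LINT \<xi>:A \<alpha> \<beta>|lborel. c z \<xi>) = of_real (2 * (Si (\<beta> * z) - Si (\<alpha> * z)))"
    if "0 < \<alpha>" "\<alpha> < \<beta>" for \<alpha> \<beta> z
  proof -
    have "c z \<in> borel_measurable borel" unfolding c_def by measurable
    then have "set_integrable lborel (A \<alpha> \<beta>) (c z)"
      using c_norm[OF that(1)] by (intro set_integrable_bounded[OF A_sets A_fin, where B = "1 / \<alpha>"]) auto
    from set_borel_integral_eq_integral(2)[OF this] show ?thesis
      using integral_unique[OF has_integral_exp_div_symmetric[OF that, of z]] by (simp add: c_def A_def)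
  qed
  have int: "((\<lambda>q. J (\<lambda>p. c (x - fst p) (fst q) * c (y - snd p) (snd q))) has_integral
      J (\<lambda>p. (LINT \<xi>:A \<alpha>1 \<beta>1|lborel. c (x - fst p) \<xi>) * (LINT \<eta>:A \<alpha>2 \<beta>2|lborel. c (y - snd p) \<eta>)))
      (A \<alpha>1 \<beta>1 \<times> A \<alpha>2 \<beta>2)"
    using c_norm[OF assms(1)] c_norm[OF assms(3)]
    by (intro J_Fubini[OF A_sets A_fin A_sets A_fin c_meas _ c_meas, where C = "1 / \<alpha>1" and D = "1 / \<alpha>2"])
  have eq: "J (\<lambda>p. c (x - fst p) (fst q) * c (y - snd p) (snd q)) = inversion_integrand f x y q"
    if "q \<in> A \<alpha>1 \<beta>1 \<times> A \<alpha>2 \<beta>2" for q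
  proof -
    obtain \<xi> \<eta> where q: "q = (\<xi>, \<eta>)" by (cases q)
    have nz: "\<xi> \<noteq> 0" "\<eta> \<noteq> 0" using that assms by (auto simp: q A_def)
    have "J (\<lambda>p. c (x - fst p) \<xi> * c (y - snd p) \<eta>) =
      J (\<lambda>p. (exp (\<i> * of_real (x * \<xi> + y * \<eta>)) / ((\<i> * of_real \<xi>) * (\<i> * of_real \<eta>))) *
        (wave \<xi> (fst p) * wave \<eta> (snd p)))"
    proof (rule arg_cong[where f = J], rule ext)
      fix p
      have "exp (\<i> * of_real ((x - fst p) * \<xi>)) * exp (\<i> * of_real ((y - snd p) * \<eta>)) =
          exp (\<i> * of_real (x * \<xi> + y * \<eta>)) * (wave \<xi> (fst p) * wave \<eta> (snd p))"
        unfolding wave_def exp_add[symmetric] by (simp add: algebra_simps)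
      then show "c (x - fst p) \<xi> * c (y - snd p) \<eta> =
          (exp (\<i> * of_real (x * \<xi> + y * \<eta>)) / ((\<i> * of_real \<xi>) * (\<i> * of_real \<eta>))) * (wave \<xi> (fst p) * wave \<eta> (snd p))"
        unfolding c_def times_divide_times_eq by (simp only: times_divide_eq_left)
    qed
    also have "\<dots> = inversion_integrand f x y q"
      unfolding J_cmult by (simp add: q inversion_integrand_def KP_fourier_eq[OF nz] transform_def)
    finally show ?thesis by (simp add: q)
  qed
  have region: "A \<alpha>1 \<beta>1 \<times> A \<alpha>2 \<beta>2 = freq_region \<alpha>1 \<alpha>2 \<beta>1 \<beta>2" by (auto simp: A_def freq_region_def)
  from has_integral_eq[OF eq int] show ?thesis
    by (simp only: region c_int[OF assms(1,2)] c_int[OF assms(3,4)] of_real_mult)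
qed

text \<open>The constant -1 in each factor is discarded by \<open>J_shift\<close>; what remains is a
  sum of two ray indicators per coordinate, whose product expands into four quadrants. Their signed
  masses are the quadrant limits of f by \<open>f_tendsto\<close>.\<close>

lemma J_sgn:
  "J (\<lambda>p. of_real (sgn (x - fst p) * sgn (y - snd p))) =
    of_real ((measure N1 ({..x} \<times> {..y}) - measure N2 ({..x} \<times> {..y})) +
      (measure N1 ({..x} \<times> {..<y}) - measure N2 ({..x} \<times> {..<y})) +
      (measure N1 ({..<x} \<times> {..y}) - measure N2 ({..<x} \<times> {..y})) +
      (measure N1 ({..<x} \<times> {..<y}) - measure N2 ({..<x} \<times> {..<y})))"
proof -
  define w where "w z u = (of_real (indicator {..<z} u + indicator {..z} u) :: complex)" for z u :: real
  let ?I = "\<lambda>A B p. complex_of_real (indicator (A \<times> B) p)"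
  have sgn: "of_real (sgn (z - u)) = w z u - 1" for z u
    by (auto simp: w_def indicator_def sgn_if)
  have w_meas: "w z \<in> borel_measurable borel" for z unfolding w_def[abs_def] by measurable
  have w_norm: "norm (w z u) \<le> 2" for z u by (auto simp: w_def indicator_def)
  have sets: "A \<times> B \<in> sets borel" if "A \<in> sets borel" "B \<in> sets borel" for A B :: "real set"
    using that by (rule borel_Times)
  have adm: "admissible (?I A B)" if "A \<in> sets borel" "B \<in> sets borel" for A B
    using sets[OF that] by (auto simp: admissible_def indicator_def intro!: exI[of _ 1])
  have add: "admissible (\<lambda>p. g p + h p)" if "admissible g" "admissible h" for g h
  proof -
    obtain B C where "g \<in> borel_measurable borel" "\<And>p. norm (g p) \<le> B" "h \<in> borel_measurable borel" "\<And>p. norm (h p) \<le> C"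
      using \<open>admissible g\<close> \<open>admissible h\<close> by (auto simp: admissible_def)
    then show ?thesis by (auto simp: admissible_def intro!: exI[of _ "B + C"] norm_triangle_mono)
  qed
  have "J (\<lambda>p. of_real (sgn (x - fst p) * sgn (y - snd p))) = J (\<lambda>p. (w x (fst p) - 1) * (w y (snd p) - 1))"
    by (simp add: sgn)
  also have "\<dots> = J (\<lambda>p. w x (fst p) * w y (snd p))"
    by (rule J_shift[OF w_meas w_norm w_meas w_norm])
  also have "\<dots> = J (\<lambda>p. ((?I {..x} {..y} p + ?I {..x} {..<y} p) + ?I {..<x} {..y} p) + ?I {..<x} {..<y} p)"
    by (rule arg_cong[where f = J]) (auto simp: w_def fun_eq_iff indicator_def)
  also have "\<dots> = J (?I {..x} {..y}) + J (?I {..x} {..<y}) + J (?I {..<x} {..y}) + J (?I {..<x} {..<y})"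
    by (simp add: J_add adm add)
  finally show ?thesis by (simp add: J_indicator sets)
qed

lemma inversion_tendsto:
  "((\<lambda>(\<alpha>1, \<alpha>2, \<beta>1, \<beta>2). integral (freq_region \<alpha>1 \<alpha>2 \<beta>1 \<beta>2) (inversion_integrand f x y)) \<longlongrightarrow>
    of_real (pi\<^sup>2) * J (\<lambda>p. of_real (sgn (x - fst p) * sgn (y - snd p))))
    (at_right 0 \<times>\<^sub>F at_right 0 \<times>\<^sub>F at_top \<times>\<^sub>F at_top)"
proof -
  let ?F = "at_right (0 :: real) \<times>\<^sub>F at_right (0 :: real) \<times>\<^sub>F (at_top :: real filter) \<times>\<^sub>F (at_top :: real filter)"
  define D where "D \<alpha> \<beta> z = 2 * (Si (\<beta> * z) - Si (\<alpha> * z))" for \<alpha> \<beta> z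
  obtain B where B: "\<And>T. \<bar>Si T\<bar> \<le> B" using bounded_Si by auto
  \<comment> \<open>Each of the two sine integrals is at most \<open>B\<close>, uniformly in the
    cut-offs and in \<open>z\<close>; this gives the majorant for \<open>J_tendsto\<close>.\<close>
  have D_bound: "\<bar>D \<alpha> \<beta> z\<bar> \<le> 4 * B" for \<alpha> \<beta> z
    using B[of "\<beta> * z"] B[of "\<alpha> * z"] by (simp add: D_def abs_le_iff)
  have [measurable]: "(\<lambda>p. D \<alpha> \<beta> (g p)) \<in> borel_measurable borel" if "g \<in> borel_measurable borel"
    for \<alpha> \<beta> and g :: "real \<times> real \<Rightarrow> real"
    using that unfolding D_def by measurable
  have [measurable]: "(fst :: real \<times> real \<Rightarrow> real) \<in> borel_measurable borel" "(snd :: real \<times> real \<Rightarrow> real) \<in> borel_measurable borel"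
    by (auto intro: projections_measurable)
  let ?h = "\<lambda>i p. complex_of_real (D (fst i) (fst (snd (snd i))) (x - fst p) * D (fst (snd i)) (snd (snd (snd i))) (y - snd p))"
  have D1: "((\<lambda>i. D (fst i) (fst (snd (snd i))) z) \<longlongrightarrow> pi * sgn z) ?F" for z
  proof -
    have "filterlim (\<lambda>i. (fst i, fst (snd (snd i)))) (at_right 0 \<times>\<^sub>F at_top) ?F"
      by (rule filterlim_Pair[OF filterlim_fst filterlim_compose[OF filterlim_fst filterlim_compose[OF filterlim_snd filterlim_snd]]])
    from filterlim_compose[OF Si_limits[of z] this] show ?thesis by (simp add: D_def)
  qed
  have D2: "((\<lambda>i. D (fst (snd i)) (snd (snd (snd i))) z) \<longlongrightarrow> pi * sgn z) ?F" for z
  proof -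
    have "filterlim (\<lambda>i. (fst (snd i), snd (snd (snd i)))) (at_right 0 \<times>\<^sub>F at_top) ?F"
      by (rule filterlim_Pair[OF filterlim_compose[OF filterlim_fst filterlim_snd]
            filterlim_compose[OF filterlim_snd filterlim_compose[OF filterlim_snd filterlim_snd]]])
    from filterlim_compose[OF Si_limits[of z] this] show ?thesis by (simp add: D_def)
  qed
  have "((\<lambda>i. J (?h i)) \<longlongrightarrow> J (\<lambda>p. of_real ((pi * sgn (x - fst p)) * (pi * sgn (y - snd p))))) ?F"
  proof (rule J_tendsto[where B = "4 * B * (4 * B)"])
    show "countably_generated ?F" by (intro countably_generated_prod countably_generated_real)
    have "\<bar>D \<alpha> \<beta> z * D \<alpha>' \<beta>' z'\<bar> \<le> 4 * B * (4 * B)" for \<alpha> \<beta> z \<alpha>' \<beta>' z'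
      unfolding abs_mult by (intro mult_mono D_bound) (use B[of 0] in auto)
    then show "\<forall>\<^sub>F i in ?F. ?h i \<in> borel_measurable borel \<and> (\<forall>p. norm (?h i p) \<le> 4 * B * (4 * B))"
      unfolding norm_of_real by (intro always_eventually allI conjI) measurable
    show "(\<lambda>p. complex_of_real ((pi * sgn (x - fst p)) * (pi * sgn (y - snd p)))) \<in> borel_measurable borel"
      by measurable
    show "((\<lambda>i. ?h i p) \<longlongrightarrow> of_real ((pi * sgn (x - fst p)) * (pi * sgn (y - snd p)))) ?F" for p
      by (intro tendsto_of_real tendsto_mult D1 D2)
  qed
  also have "J (\<lambda>p. of_real ((pi * sgn (x - fst p)) * (pi * sgn (y - snd p)))) =
      of_real (pi\<^sup>2) * J (\<lambda>p. of_real (sgn (x - fst p) * sgn (y - snd p)))"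
    unfolding J_cmult[symmetric] by (simp add: power2_eq_square ac_simps)
  finally have lim: "((\<lambda>i. J (?h i)) \<longlongrightarrow> of_real (pi\<^sup>2) * J (\<lambda>p. of_real (sgn (x - fst p) * sgn (y - snd p)))) ?F" .
  \<comment> \<open>Eventually the lower cut-offs are below 1 and the upper ones above 1, so the
    regions meet the hypotheses of \<open>inversion_integrand_has_integral\<close>.\<close>
  have "\<forall>\<^sub>F a in at_right (0::real). 0 < a \<and> a < 1"
    by (auto simp: eventually_at_right_field intro!: exI[of _ 1])
  from eventually_prodI[OF this eventually_prodI[OF this eventually_prodI[OF eventually_gt_at_top[of 1] eventually_gt_at_top[of 1]]]]
  have "\<forall>\<^sub>F i in ?F. J (?h i) =
      (case i of (\<alpha>1, \<alpha>2, \<beta>1, \<beta>2) \<Rightarrow> integral (freq_region \<alpha>1 \<alpha>2 \<beta>1 \<beta>2) (inversion_integrand f x y))"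
  proof (rule eventually_mono)
    fix i :: "real \<times> real \<times> real \<times> real"
    obtain \<alpha>1 \<alpha>2 \<beta>1 \<beta>2 where i: "i = (\<alpha>1, \<alpha>2, \<beta>1, \<beta>2)" by (metis prod.exhaust)
    assume "(0 < fst i \<and> fst i < 1) \<and> (0 < fst (snd i) \<and> fst (snd i) < 1) \<and> 1 < fst (snd (snd i)) \<and> 1 < snd (snd (snd i))"
    then have "0 < \<alpha>1" "\<alpha>1 < \<beta>1" "0 < \<alpha>2" "\<alpha>2 < \<beta>2" by (auto simp: i)
    from integral_unique[OF inversion_integrand_has_integral[OF this, of x y]]
    show "J (?h i) = (case i of (\<alpha>1, \<alpha>2, \<beta>1, \<beta>2) \<Rightarrow> integral (freq_region \<alpha>1 \<alpha>2 \<beta>1 \<beta>2) (inversion_integrand f x y))"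
      by (simp only: i D_def prod.case fst_conv snd_conv)
  qed
  with lim show ?thesis by (rule Lim_transform_eventually)
qed

end

text \<open>Existence of the transform, integrability and the quadrant limits are asserted along
  with the formula, because \<open>THE\<close> and \<open>integral\<close> have values even where
  nothing converges.\<close>

theorem theorem4p1:
  fixes f :: "real \<times> real \<Rightarrow> real" and x y :: real
  assumes "f \<in> BV_norm0"
  shows "(\<forall>\<xi> \<eta>. \<xi> \<noteq> 0 \<longrightarrow> \<eta> \<noteq> 0 \<longrightarrow> (\<exists>z. has_KP_fourier f \<xi> \<eta> z)) \<and>
    (\<forall>\<alpha>1 \<alpha>2 \<beta>1 \<beta>2. 0 < \<alpha>1 \<longrightarrow> \<alpha>1 < \<beta>1 \<longrightarrow> 0 < \<alpha>2 \<longrightarrow> \<alpha>2 < \<beta>2 \<longrightarrow>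
       inversion_integrand f x y integrable_on freq_region \<alpha>1 \<alpha>2 \<beta>1 \<beta>2) \<and>
    (\<exists>fpp fpm fmp fmm :: real.
       (f \<longlongrightarrow> fpp) (at_right x \<times>\<^sub>F at_right y) \<and>
       (f \<longlongrightarrow> fpm) (at_right x \<times>\<^sub>F at_left y) \<and>
       (f \<longlongrightarrow> fmp) (at_left x \<times>\<^sub>F at_right y) \<and>
       (f \<longlongrightarrow> fmm) (at_left x \<times>\<^sub>F at_left y) \<and>
       ((\<lambda>(\<alpha>1, \<alpha>2, \<beta>1, \<beta>2).
           1 / (4 * of_real pi ^ 2) *
           integral (freq_region \<alpha>1 \<alpha>2 \<beta>1 \<beta>2) (inversion_integrand f x y))
         \<longlongrightarrow> complex_of_real ((fpp + fpm + fmp + fmm) / 4))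
         (at_right 0 \<times>\<^sub>F at_right 0 \<times>\<^sub>F at_top \<times>\<^sub>F at_top))"
proof -
  obtain G H where GH: "distribution_like G" "distribution_like H" "\<And>p. f p = G p - H p"
    using BV_norm0_Jordan[OF assms] by blast
  obtain N1 N2 where N: "represents N1 G" "represents N2 H"
    using represents_exists GH by metis
  have "(f \<longlongrightarrow> 0) at_infinity" using assms by (simp add: BV_norm0_def)
  then interpret represented_function f G H N1 N2
    using GH N by unfold_locales
  let ?m = "\<lambda>A B. measure N1 (A \<times> B) - measure N2 (A \<times> B)"
  have "((\<lambda>i. 1 / (4 * of_real pi ^ 2) * (case i of (\<alpha>1, \<alpha>2, \<beta>1, \<beta>2) \<Rightarrow>
      integral (freq_region \<alpha>1 \<alpha>2 \<beta>1 \<beta>2) (inversion_integrand f x y))) \<longlongrightarrow>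
      1 / (4 * of_real pi ^ 2) * (of_real (pi\<^sup>2) * J (\<lambda>p. of_real (sgn (x - fst p) * sgn (y - snd p)))))
      (at_right 0 \<times>\<^sub>F at_right 0 \<times>\<^sub>F at_top \<times>\<^sub>F at_top)"
    by (intro tendsto_mult tendsto_const inversion_tendsto)
  \<comment> \<open>The factor \<open>pi\<^sup>2\<close> from the two sine integrals leaves 1/4, the
    weight of each quadrant.\<close>
  also have "1 / (4 * of_real pi ^ 2) * (of_real (pi\<^sup>2) * J (\<lambda>p. of_real (sgn (x - fst p) * sgn (y - snd p)))) =
      complex_of_real ((?m {..x} {..y} + ?m {..x} {..<y} + ?m {..<x} {..y} + ?m {..<x} {..<y}) / 4)"
    unfolding J_sgn by (simp add: field_simps)
  finally have lim: "((\<lambda>(\<alpha>1, \<alpha>2, \<beta>1, \<beta>2). 1 / (4 * of_real pi ^ 2) *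
      integral (freq_region \<alpha>1 \<alpha>2 \<beta>1 \<beta>2) (inversion_integrand f x y)) \<longlongrightarrow>
      complex_of_real ((?m {..x} {..y} + ?m {..x} {..<y} + ?m {..<x} {..y} + ?m {..<x} {..<y}) / 4))
      (at_right 0 \<times>\<^sub>F at_right 0 \<times>\<^sub>F at_top \<times>\<^sub>F at_top)"
    by (simp only: case_prod_unfold)
  note rays = ray_limit_at_left ray_limit_at_right
  have "\<exists>z. has_KP_fourier f \<xi> \<eta> z" if "\<xi> \<noteq> 0" "\<eta> \<noteq> 0" for \<xi> \<eta>
    using has_KP_fourier_transform[OF that] ..
  moreover have "inversion_integrand f x y integrable_on freq_region \<alpha>1 \<alpha>2 \<beta>1 \<beta>2"
    if "0 < \<alpha>1" "\<alpha>1 < \<beta>1" "0 < \<alpha>2" "\<alpha>2 < \<beta>2" for \<alpha>1 \<alpha>2 \<beta>1 \<beta>2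
    using inversion_integrand_has_integral[OF that] by (rule has_integral_integrable)
  ultimately show ?thesis
    by (intro conjI allI impI exI[of _ "?m {..x} {..y}"] exI[of _ "?m {..x} {..<y}"]
        exI[of _ "?m {..<x} {..y}"] exI[of _ "?m {..<x} {..<y}"] f_tendsto rays lim)
qed

end
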